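(* Let $W(y,z|x)$ be a discrete memoryless wiretap channel (not assumed degraded) with finite alphabets $\mathcal{X},\mathcal{Y},\mathcal{Z}$. Then for every $\epsilon\in[0,1)$, \[ \mathcal{C}_s(\epsilon|W)=\mathcal{C}_s(0|W), \] where $\mathcal{C}_s(\epsilon|W)$ is the maximal $\epsilon$-achievable rate over sequences of codes satisfying the secrecy condition $\lim_{n\to\infty}\frac1n I(M_n;Z^n)=0$ (all terms as defined in the context).
   Context: A discrete memoryless wiretap channel has a transmitter with input alphabet $\mathcal{X}$, a legitimate receiver observing $\mathcal{Y}$ and an eavesdropper observing $\mathcal{Z}$ (finite sets), with $n$-letter channel $W^n(y^n,z^n|x^n)=\prod_{t=1}^n W(y_t,z_t|x_t)$. A code of length $n$ consists of a finite message set $\mathcal{M}_n$, a stochastic encoder $\phi^{(n)}(x^n|m)$ (a conditional pmf on $\mathcal{X}^n$ given $m\in\mathcal{M}_n$) and a decoder $\psi^{(n)}:\mathcal{Y}^n\to\mathcal{M}_n$. The induced joint pmf is $p_{M_nX^nY^nZ^n}(m,x^n,y^n,z^n)=\frac{1}{|\mathcal{M}_n|}\phi^{(n)}(x^n|m)\prod_{t=1}^n W(y_t,z_t|x_t)$ (message uniform). The probability of correct decoding is $P_c^{(n)}=\Pr\{\psi^{(n)}(Y^n)=M_n\}$ and the error probability is $P_e^{(n)}=1-P_c^{(n)}$. For $\epsilon\in[0,1)$, a rate $R$ is $\epsilon$-achievable if there is a sequence of codes $\{(\phi^{(n)},\psi^{(n)})\}_{n\ge1}$ with $\limsup_{n\to\infty}P_e^{(n)}\le\epsilon$,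 $\liminf_{n\to\infty}\frac1n\log|\mathcal{M}_n|\ge R$, and $\lim_{n\to\infty}\frac1n I(M_n;Z^n)=0$. $\mathcal{C}_s(\epsilon|W)$ denotes the supremum of $\epsilon$-achievable rates. (It is known, by Csiszár–Körner, that $\mathcal{C}_s(0|W)=\max I(U;Y)-I(U;Z)$, the maximum over joint pmfs $p_{UXYZ}$ with $|\mathcal{U}|\le|\mathcal{X}|$, $p_{YZ|X}=W$, and $U\to X\to(Y,Z)$ a Markov chain.) *)

theory Defs
  imports "HOL-Analysis.Analysis" "HOL-Library.Liminf_Limsup"
begin

definition is_channel :: "('x::finite \<Rightarrow> 'y::finite \<Rightarrow> 'z::finite \<Rightarrow> real) \<Rightarrow> bool" where
  "is_channel W \<longleftrightarrow> (\<forall>x y z. W x y z \<ge> 0) \<and> (\<forall>x. (\<Sum>y\<in>UNIV. \<Sum>z\<in>UNIV. W x y z) = 1)"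

definition seqs :: "nat \<Rightarrow> 'a list set" where
  "seqs n = {xs. length xs = n}"

definition Wn :: "('x \<Rightarrow> 'y \<Rightarrow> 'z \<Rightarrow> real) \<Rightarrow> nat \<Rightarrow> 'x list \<Rightarrow> 'y list \<Rightarrow> 'z list \<Rightarrow> real" where
  "Wn W n xs ys zs = (\<Prod>t<n. W (xs ! t) (ys ! t) (zs ! t))"

definition is_code :: "nat \<Rightarrow> nat \<Rightarrow> (nat \<Rightarrow> 'x list \<Rightarrow> real) \<Rightarrow> ('y list \<Rightarrow> nat) \<Rightarrow> bool" where
  "is_code n K phi psi \<longleftrightarrow> K \<ge> 1
     \<and> (\<forall>m<K. (\<forall>xs. phi m xs \<ge> 0) \<and> (\<Sum>xs\<in>seqs n. phi m xs) = 1)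
     \<and> (\<forall>ys\<in>seqs n. psi ys < K)"

definition joint :: "('x \<Rightarrow> 'y \<Rightarrow> 'z \<Rightarrow> real) \<Rightarrow> nat \<Rightarrow> nat \<Rightarrow> (nat \<Rightarrow> 'x list \<Rightarrow> real)
    \<Rightarrow> nat \<Rightarrow> 'x list \<Rightarrow> 'y list \<Rightarrow> 'z list \<Rightarrow> real" where
  "joint W n K phi m xs ys zs = (1 / real K) * phi m xs * Wn W n xs ys zs"

definition prob_correct :: "('x::finite \<Rightarrow> 'y::finite \<Rightarrow> 'z::finite \<Rightarrow> real) \<Rightarrow> nat \<Rightarrow> nat
    \<Rightarrow> (nat \<Rightarrow> 'x list \<Rightarrow> real) \<Rightarrow> ('y list \<Rightarrow> nat) \<Rightarrow> real" where
  "prob_correct W n K phi psi =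
     (\<Sum>m<K. \<Sum>xs\<in>seqs n. \<Sum>ys\<in>seqs n. \<Sum>zs\<in>seqs n.
        if psi ys = m then joint W n K phi m xs ys zs else 0)"

definition prob_error :: "('x::finite \<Rightarrow> 'y::finite \<Rightarrow> 'z::finite \<Rightarrow> real) \<Rightarrow> nat \<Rightarrow> nat
    \<Rightarrow> (nat \<Rightarrow> 'x list \<Rightarrow> real) \<Rightarrow> ('y list \<Rightarrow> nat) \<Rightarrow> real" where
  "prob_error W n K phi psi = 1 - prob_correct W n K phi psi"

definition p_MZ :: "('x::finite \<Rightarrow> 'y::finite \<Rightarrow> 'z::finite \<Rightarrow> real) \<Rightarrow> nat \<Rightarrow> nat
    \<Rightarrow> (nat \<Rightarrow> 'x list \<Rightarrow> real) \<Rightarrow> nat \<Rightarrow> 'z list \<Rightarrow> real" where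
  "p_MZ W n K phi m zs = (\<Sum>xs\<in>seqs n. \<Sum>ys\<in>seqs n. joint W n K phi m xs ys zs)"

definition p_Z :: "('x::finite \<Rightarrow> 'y::finite \<Rightarrow> 'z::finite \<Rightarrow> real) \<Rightarrow> nat \<Rightarrow> nat
    \<Rightarrow> (nat \<Rightarrow> 'x list \<Rightarrow> real) \<Rightarrow> 'z list \<Rightarrow> real" where
  "p_Z W n K phi zs = (\<Sum>m<K. p_MZ W n K phi m zs)"

definition mutual_info_MZ :: "('x::finite \<Rightarrow> 'y::finite \<Rightarrow> 'z::finite \<Rightarrow> real) \<Rightarrow> nat \<Rightarrow> nat
    \<Rightarrow> (nat \<Rightarrow> 'x list \<Rightarrow> real) \<Rightarrow> real" where
  "mutual_info_MZ W n K phi =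
     (\<Sum>m<K. \<Sum>zs\<in>seqs n.
        if p_MZ W n K phi m zs = 0 then 0
        else p_MZ W n K phi m zs *
             ln (p_MZ W n K phi m zs / ((1 / real K) * p_Z W n K phi zs)))"

text \<open>epsilon-achievability (rates measured in nats, consistently with the mutual information).\<close>
definition eps_achievable :: "('x::finite \<Rightarrow> 'y::finite \<Rightarrow> 'z::finite \<Rightarrow> real) \<Rightarrow> real \<Rightarrow> real \<Rightarrow> bool" where
  "eps_achievable W \<epsilon> R \<longleftrightarrow>
     (\<exists>(K :: nat \<Rightarrow> nat) (phi :: nat \<Rightarrow> nat \<Rightarrow> 'x list \<Rightarrow> real) (psi :: nat \<Rightarrow> 'y list \<Rightarrow> nat).
        (\<forall>n\<ge>1. is_code n (K n) (phi n) (psi n))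
      \<and> limsup (\<lambda>n. ereal (prob_error W n (K n) (phi n) (psi n))) \<le> ereal \<epsilon>
      \<and> liminf (\<lambda>n. ereal (ln (real (K n)) / real n)) \<ge> ereal R
      \<and> (\<lambda>n. mutual_info_MZ W n (K n) (phi n) / real n) \<longlonglongrightarrow> 0)"

definition secrecy_capacity :: "('x::finite \<Rightarrow> 'y::finite \<Rightarrow> 'z::finite \<Rightarrow> real) \<Rightarrow> real \<Rightarrow> real" where
  "secrecy_capacity W \<epsilon> = Sup {R. eps_achievable W \<epsilon> R}"

end

theory Submission
  imports Defs "HOL-Real_Asymp.Real_Asymp"
begin

text \<open>
  Achievable rates are compared directly, without a single-letter formula. Given codes with error at
  most \<open>\<epsilon> < 1\<close>, condition on the likely event \<open>G\<close> of those pairs \<open>(m, x)\<close> for which the decoding set of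
  \<open>m\<close> has probability at least \<open>\<eta>\<close> given \<open>x\<close>. The channel from \<open>x\<close> is untouched by this conditioning, and the
  leakage stays \<open>o(n)\<close> because probabilities grow by at most \<open>1 / \<eta>\<close>. By a variance bound the
  received word is within expected Hamming distance \<open>O(sqrt n)\<close> of the decoding set of the message, so
  guessing the message from a slightly perturbed output shows that the message has conditional entropy
  \<open>o(n)\<close>. Hence the inner channel given by the block code has
  \<open>I(M;Y\<^sup>n) - I(M;Z\<^sup>n) \<ge> ln K - o(n)\<close>, and random coding over many copies of this inner channel
  achieves the same rate with vanishing error.
\<close>

text \<open>The obstacle is that Fano's inequality, for an error bounded only away from 1, leaves a
  multiple of \<open>ln K\<close>, a term linear in the block length. Conditioning on correct
  decoding would remove the error, but the output law would then depend on the decoder, and the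
  result would no longer be an encoder followed by the given channel, fit to be a letter of an outer
  code. An event in \<open>(m, x)\<close> alone avoids this, at the price that decoding succeeds
  only with probability at least \<eta> given \<open>x\<close>. The Hamming estimate repairs that:
  the noisy guess costs \<open>- n * ln (1 - s)\<close> plus a multiple of \<open>sqrt n\<close>. As
  s stays fixed while n grows, the first cost is an arbitrarily small fraction of n and the second
  is negligible.

  Only one sufficiently long code of the given sequence is ever used. Its length is then frozen, and
  the error vanishes through the number of copies. Second moments suffice for the random coding,
  since the error only has to vanish and the leakage only has to be sublinear.\<close>

section \<open>Words, memoryless channels and their marginals\<close>

text \<open>The letters of the outer code form a finite subset of a type, the messages of positive
  conditional probability, so the alphabet is a set; \<open>seqs\<close> is the case
  \<open>UNIV\<close>.\<close>

definition words :: "'a set \<Rightarrow> nat \<Rightarrow> 'a list set" where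
  "words S n = {xs. set xs \<subseteq> S \<and> length xs = n}"

lemma words_0 [simp]: "words S 0 = {[]}"
  by (auto simp: words_def)

lemma finite_words [simp]: "finite S \<Longrightarrow> finite (words S n)"
  unfolding words_def by (rule finite_lists_length_eq)

lemma seqs_eq_words: "seqs n = words UNIV n"
  by (simp add: seqs_def words_def)

lemma finite_seqs [simp]: "finite (seqs n :: 'a::finite list set)"
  by (simp add: seqs_eq_words)

lemma length_seqs: "xs \<in> seqs n \<Longrightarrow> length xs = n"
  by (simp add: seqs_def)

lemma seqs_0 [simp]: "seqs 0 = {[]}"
  by (simp add: seqs_def)

lemma sum_words_Suc:
  "sum g (words S (Suc n)) = (\<Sum>x\<in>S. \<Sum>xs\<in>words S n. g (x # xs))"
proof -
  have "words S (Suc n) = (\<lambda>(x, xs). x # xs) ` (S \<times> words S n)"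
    by (auto simp: words_def length_Suc_conv image_iff)
  moreover have "inj_on (\<lambda>(x, xs). x # xs) (S \<times> words S n)"
    by (auto simp: inj_on_def)
  ultimately have "sum g (words S (Suc n)) = (\<Sum>(x, xs)\<in>S \<times> words S n. g (x # xs))"
    by (simp add: sum.reindex case_prod_unfold)
  then show ?thesis by (simp add: sum.cartesian_product)
qed

lemma sum_seqs_Suc:
  "sum g (seqs (Suc n)) = (\<Sum>x\<in>UNIV. \<Sum>xs\<in>seqs n. g (x # xs))"
  unfolding seqs_eq_words by (rule sum_words_Suc)

lemma sum_seqs_append:
  "sum g (seqs (n + m)) = (\<Sum>xs\<in>seqs n. \<Sum>ys\<in>seqs m. g (xs @ ys))"
proof (induction n arbitrary: g)
  case (Suc n)
  show ?case by (simp add: sum_seqs_Suc Suc)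
qed simp

lemma seqs_Suc_iff: "xs \<in> seqs (Suc n) \<longleftrightarrow> (\<exists>y ys. xs = y # ys \<and> ys \<in> seqs n)"
  by (auto simp: seqs_def length_Suc_conv)

text \<open>For words of equal length this is the memoryless product. The recursion fits the peeling
  of letters and blocks off lists better than the indexed product in \<open>Wn\<close>; unequal
  lengths give 0.\<close>

fun wn :: "('x \<Rightarrow> 'y \<Rightarrow> real) \<Rightarrow> 'x list \<Rightarrow> 'y list \<Rightarrow> real" where
  "wn V [] [] = 1"
| "wn V (x # xs) (y # ys) = V x y * wn V xs ys"
| "wn V _ _ = 0"

definition stochastic :: "('x \<Rightarrow> 'y::finite \<Rightarrow> real) \<Rightarrow> bool" where
  "stochastic V \<longleftrightarrow> (\<forall>x y. 0 \<le> V x y) \<and> (\<forall>x. (\<Sum>y\<in>UNIV. V x y) = 1)"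

lemma stochastic_nonneg: "stochastic V \<Longrightarrow> 0 \<le> V x y"
  by (simp add: stochastic_def)

lemma stochastic_sum: "stochastic V \<Longrightarrow> (\<Sum>y\<in>UNIV. V x y) = 1"
  by (simp add: stochastic_def)

lemma wn_nonneg: "stochastic V \<Longrightarrow> 0 \<le> wn V xs ys"
  by (induction V xs ys rule: wn.induct) (auto simp: stochastic_nonneg)

lemma sum_wn: "stochastic V \<Longrightarrow> length xs = n \<Longrightarrow> (\<Sum>ys\<in>seqs n. wn V xs ys) = 1"
proof (induction xs arbitrary: n)
  case (Cons x xs)
  then obtain m where "n = Suc m" "length xs = m" by auto
  with Cons show ?case
    by (simp add: sum_seqs_Suc stochastic_sum flip: sum_distrib_left)
qed simp

lemma wn_append:
  "length a = length c \<Longrightarrow> wn V (a @ b) (c @ d) = wn V a c * wn V b d"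
  by (induction a c rule: list_induct2) auto

definition margY :: "('x \<Rightarrow> 'y \<Rightarrow> 'z::finite \<Rightarrow> real) \<Rightarrow> 'x \<Rightarrow> 'y \<Rightarrow> real" where
  "margY W x y = (\<Sum>z\<in>UNIV. W x y z)"

definition margZ :: "('x \<Rightarrow> 'y::finite \<Rightarrow> 'z \<Rightarrow> real) \<Rightarrow> 'x \<Rightarrow> 'z \<Rightarrow> real" where
  "margZ W x z = (\<Sum>y\<in>UNIV. W x y z)"

lemma stochastic_margY: "is_channel W \<Longrightarrow> stochastic (margY W)"
  by (simp add: is_channel_def stochastic_def margY_def sum_nonneg)

lemma stochastic_margZ:
  assumes "is_channel W" shows "stochastic (margZ W)"
proof -
  have "(\<Sum>z\<in>UNIV. margZ W x z) = (\<Sum>y\<in>UNIV. \<Sum>z\<in>UNIV. W x y z)" for x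
    unfolding margZ_def by (rule sum.swap)
  then show ?thesis
    using assms by (simp add: is_channel_def stochastic_def margZ_def sum_nonneg)
qed

lemma Wn_Cons: "Wn W (Suc n) (x # xs) (y # ys) (z # zs) = W x y z * Wn W n xs ys zs"
  unfolding Wn_def by (subst prod.lessThan_Suc_shift) simp

lemma sum_Wn_Z:
  "xs \<in> seqs n \<Longrightarrow> ys \<in> seqs n \<Longrightarrow> (\<Sum>zs\<in>seqs n. Wn W n xs ys zs) = wn (margY W) xs ys"
proof (induction n arbitrary: xs ys)
  case 0
  then show ?case by (simp add: Wn_def)
next
  case (Suc n)
  then obtain x xs' y ys' where *: "xs = x # xs'" "ys = y # ys'" "xs' \<in> seqs n" "ys' \<in> seqs n"
    by (auto simp: seqs_Suc_iff)
  then show ?case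
    by (simp add: sum_seqs_Suc Wn_Cons Suc.IH margY_def sum_distrib_right flip: sum_distrib_left)
qed

lemma sum_Wn_Y:
  "xs \<in> seqs n \<Longrightarrow> zs \<in> seqs n \<Longrightarrow> (\<Sum>ys\<in>seqs n. Wn W n xs ys zs) = wn (margZ W) xs zs"
proof (induction n arbitrary: xs zs)
  case 0
  then show ?case by (simp add: Wn_def)
next
  case (Suc n)
  then obtain x xs' y ys' where *: "xs = x # xs'" "zs = y # ys'" "xs' \<in> seqs n" "ys' \<in> seqs n"
    by (auto simp: seqs_Suc_iff)
  then show ?case
    by (simp add: sum_seqs_Suc Wn_Cons Suc.IH margZ_def sum_distrib_right flip: sum_distrib_left)
qed

text \<open>The channel from an abstract letter u to n-letter outputs, through the stochastic
  encoder f. The letter is a message when f is a code, and a list of letters when f is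
  \<open>blockenc\<close>.\<close>

definition outch :: "('u \<Rightarrow> 'x list \<Rightarrow> real) \<Rightarrow> ('x \<Rightarrow> 'y \<Rightarrow> real) \<Rightarrow> nat \<Rightarrow> 'u \<Rightarrow> 'y list \<Rightarrow> real" where
  "outch f V n u ys = (\<Sum>xs\<in>seqs n. f u xs * wn V xs ys)"

lemma prob_correct_eq:
  assumes "is_code n K phi psi"
  shows "prob_correct W n K phi psi
    = (1 / real K) * (\<Sum>ys\<in>seqs n. outch phi (margY W) n (psi ys) ys)"
proof -
  have "prob_correct W n K phi psi
    = (\<Sum>m<K. \<Sum>xs\<in>seqs n. \<Sum>ys\<in>seqs n. if psi ys = m then 1 / real K * (phi m xs * wn (margY W) xs ys) else 0)"
    unfolding prob_correct_def joint_def
    by (intro sum.cong refl) (auto simp: sum_Wn_Z simp flip: sum_distrib_left sum_divide_distrib)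
  also have "\<dots> = (\<Sum>m<K. \<Sum>ys\<in>seqs n. if psi ys = m then 1 / real K * outch phi (margY W) n m ys else 0)"
    unfolding outch_def
    by (intro sum.cong refl, subst sum.swap, intro sum.cong refl) (simp add: sum_distrib_left)
  also have "\<dots> = (\<Sum>ys\<in>seqs n. \<Sum>m<K. if psi ys = m then 1 / real K * outch phi (margY W) n m ys else 0)"
    by (rule sum.swap)
  also have "\<dots> = (\<Sum>ys\<in>seqs n. 1 / real K * outch phi (margY W) n (psi ys) ys)"
    using assms by (intro sum.cong refl) (simp add: is_code_def)
  finally show ?thesis by (simp add: sum_distrib_left)
qed

lemma p_MZ_eq:
  assumes "zs \<in> seqs n"
  shows "p_MZ W n K phi m zs = (1 / real K) * outch phi (margZ W) n m zs"
proof -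
  have "p_MZ W n K phi m zs
    = (\<Sum>xs\<in>seqs n. 1 / real K * (phi m xs * (\<Sum>ys\<in>seqs n. Wn W n xs ys zs)))"
    unfolding p_MZ_def joint_def by (simp add: sum_distrib_left mult.assoc)
  also have "\<dots> = (\<Sum>xs\<in>seqs n. 1 / real K * (phi m xs * wn (margZ W) xs zs))"
    using assms by (intro sum.cong refl) (simp add: sum_Wn_Y)
  finally show ?thesis by (simp add: outch_def sum_distrib_left)
qed

lemma outch_nonneg:
  "stochastic V \<Longrightarrow> (\<And>xs. 0 \<le> f u xs) \<Longrightarrow> 0 \<le> outch f V n u ys"
  unfolding outch_def by (intro sum_nonneg mult_nonneg_nonneg wn_nonneg)

lemma sum_outch:
  fixes V :: "'x::finite \<Rightarrow> 'y::finite \<Rightarrow> real"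
  assumes "stochastic V"
  shows "(\<Sum>ys\<in>seqs n. outch f V n u ys) = (\<Sum>xs\<in>seqs n. f u xs)"
proof -
  have "(\<Sum>ys\<in>seqs n. outch f V n u ys) = (\<Sum>xs\<in>seqs n. f u xs * (\<Sum>ys\<in>seqs n. wn V xs ys))"
    unfolding outch_def by (subst sum.swap) (simp add: sum_distrib_left)
  then show ?thesis using assms by (simp add: sum_wn length_seqs)
qed

section \<open>Nonnegativity of divergence, and mutual information\<close>

text \<open>This is \<open>ln x \<le> x - 1\<close> at \<open>x = Q / P\<close>, unnormalised.
  Besides giving \<open>gibbs\<close> by summation, it bounds the negative part of an information
  density in \<open>minfo_le_mutual_info\<close>.\<close>

lemma gibbs_term:
  fixes P Q :: real
  assumes "0 \<le> P" "0 \<le> Q" "Q = 0 \<Longrightarrow> P = 0"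
  shows "P - Q \<le> P * ln (P / Q)"
proof (cases "P = 0")
  case False
  then have pos: "0 < P" "0 < Q" using assms by (auto simp: less_le)
  have "ln (Q / P) \<le> Q / P - 1" using pos by (intro ln_le_minus_one) simp
  then have "P * ln (Q / P) \<le> P * (Q / P - 1)" using pos by (intro mult_left_mono) auto
  then show ?thesis using pos by (simp add: ln_div algebra_simps)
qed (use assms in simp)

text \<open>The total masses may differ as long as Q has the smaller one. This matters where Q is a
  guessing law of mass at most 1, or a uniform law restricted to a subset.\<close>

lemma gibbs:
  fixes P Q :: "'a \<Rightarrow> real"
  assumes "\<And>a. a \<in> A \<Longrightarrow> 0 \<le> P a" "\<And>a. a \<in> A \<Longrightarrow> 0 \<le> Q a"
    "\<And>a. a \<in> A \<Longrightarrow> Q a = 0 \<Longrightarrow> P a = 0" "sum Q A \<le> sum P A"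
  shows "0 \<le> (\<Sum>a\<in>A. P a * ln (P a / Q a))"
proof -
  have "(\<Sum>a\<in>A. P a - Q a) \<le> (\<Sum>a\<in>A. P a * ln (P a / Q a))"
    using assms by (intro sum_mono gibbs_term) auto
  then show ?thesis using assms(4) by (simp add: sum_subtractf)
qed

definition out :: "'u set \<Rightarrow> ('u \<Rightarrow> real) \<Rightarrow> ('u \<Rightarrow> 'a \<Rightarrow> real) \<Rightarrow> 'a \<Rightarrow> real" where
  "out S p v a = (\<Sum>u\<in>S. p u * v u a)"

text \<open>Mutual information of the input law p on S and the channel v. Terms with
  \<open>v u a = 0\<close> vanish through the factor in front of \<open>ln\<close>.\<close>

definition minfo :: "'u set \<Rightarrow> ('u \<Rightarrow> real) \<Rightarrow> ('u \<Rightarrow> 'a \<Rightarrow> real) \<Rightarrow> 'a set \<Rightarrow> real" where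
  "minfo S p v A = (\<Sum>u\<in>S. \<Sum>a\<in>A. p u * v u a * ln (v u a / out S p v a))"

section \<open>Random coding\<close>

text \<open>Expectation over a random codebook indexed by I, with independent entries of law
  p.\<close>

definition avg :: "'i set \<Rightarrow> 'u set \<Rightarrow> ('u \<Rightarrow> real) \<Rightarrow> (('i \<Rightarrow> 'u) \<Rightarrow> real) \<Rightarrow> real" where
  "avg I S p X = (\<Sum>c\<in>PiE I (\<lambda>_. S). (\<Prod>k\<in>I. p (c k)) * X c)"

lemma avg_add: "avg I S p (\<lambda>c. X c + Y c) = avg I S p X + avg I S p Y"
  by (simp add: avg_def sum.distrib algebra_simps)

lemma avg_diff: "avg I S p (\<lambda>c. X c - Y c) = avg I S p X - avg I S p Y"
  by (simp add: avg_def sum_subtractf algebra_simps)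

lemma avg_cmult: "avg I S p (\<lambda>c. a * X c) = a * avg I S p X"
  by (simp add: avg_def sum_distrib_left algebra_simps)

lemma avg_sum: "avg I S p (\<lambda>c. \<Sum>j\<in>J. X j c) = (\<Sum>j\<in>J. avg I S p (X j))"
  unfolding avg_def sum_distrib_left by (rule sum.swap)

lemma avg_mono:
  assumes "\<And>u. u \<in> S \<Longrightarrow> 0 \<le> p u" "\<And>c. c \<in> PiE I (\<lambda>_. S) \<Longrightarrow> X c \<le> Y c"
  shows "avg I S p X \<le> avg I S p Y"
  unfolding avg_def using assms by (intro sum_mono mult_left_mono prod_nonneg) auto

lemma avg_product:
  assumes I: "finite I" and S: "finite S"
  shows "avg I S p (\<lambda>c. \<Prod>k\<in>I. g k (c k)) = (\<Prod>k\<in>I. \<Sum>u\<in>S. p u * g k u)"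
proof -
  have "(\<Prod>k\<in>I. \<Sum>u\<in>S. p u * g k u) = (\<Sum>c\<in>PiE I (\<lambda>_. S). \<Prod>k\<in>I. p (c k) * g k (c k))"
    using I S by (rule prod_sum_PiE)
  then show ?thesis by (simp add: avg_def prod.distrib)
qed

lemma avg_const:
  assumes "finite I" "finite S" "sum p S = 1"
  shows "avg I S p (\<lambda>c. a) = a"
  using avg_product[of I S p "\<lambda>_ _. 1"] avg_cmult[of I S p a "\<lambda>_. 1"] assms by simp

lemma avg_single:
  assumes "finite I" "finite S" "sum p S = 1" "i \<in> I"
  shows "avg I S p (\<lambda>c. g (c i)) = (\<Sum>u\<in>S. p u * g u)"
proof -
  have "avg I S p (\<lambda>c. g (c i)) = avg I S p (\<lambda>c. \<Prod>k\<in>I. if k = i then g (c k) else 1)"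
    using assms by (simp add: prod.delta)
  also have "\<dots> = (\<Prod>k\<in>I. \<Sum>u\<in>S. p u * (if k = i then g u else 1))"
    using assms by (subst avg_product) auto
  also have "\<dots> = (\<Prod>k\<in>I. if k = i then \<Sum>u\<in>S. p u * g u else 1)"
    using assms by (intro prod.cong) auto
  finally show ?thesis using assms by (simp add: prod.delta)
qed

lemma avg_pair:
  assumes "finite I" "finite S" "sum p S = 1" "i \<in> I" "j \<in> I" "i \<noteq> j"
  shows "avg I S p (\<lambda>c. g (c i) * h (c j)) = (\<Sum>u\<in>S. p u * g u) * (\<Sum>u\<in>S. p u * h u)"
proof -
  have "avg I S p (\<lambda>c. g (c i) * h (c j))
      = avg I S p (\<lambda>c. \<Prod>k\<in>I. (if k = i then g (c k) else 1) * (if k = j then h (c k) else 1))"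
    using assms by (simp add: prod.delta prod.distrib)
  also have "\<dots> = (\<Prod>k\<in>I. \<Sum>u\<in>S. p u * ((if k = i then g u else 1) * (if k = j then h u else 1)))"
    using assms by (subst avg_product[where g = "\<lambda>k u. (if k = i then g u else 1) * (if k = j then h u else 1)"]) auto
  also have "\<dots> = (\<Prod>k\<in>I. (if k = i then \<Sum>u\<in>S. p u * g u else 1) * (if k = j then \<Sum>u\<in>S. p u * h u else 1))"
    using assms by (intro prod.cong) auto
  finally show ?thesis using assms by (simp add: prod.delta prod.distrib)
qed

text \<open>The entry \<open>c i\<close> is correlated with its own term of the sum and independent
  of the other \<open>card J - 1\<close> terms, each of which averages to the mean of w. Affine
  dependence on the sum can be averaged exactly, so the two nonlinear functions of such sums below
  are first replaced by tangents.\<close>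

lemma avg_affine:
  assumes "finite I" "finite S" "sum p S = 1" "J \<subseteq> I" "i \<in> J"
  shows "avg I S p (\<lambda>c. g (c i) + h (c i) * (\<Sum>j\<in>J. w (c j)))
    = (\<Sum>u\<in>S. p u * (g u + h u * (w u + (real (card J) - 1) * (\<Sum>u'\<in>S. p u' * w u'))))"
proof -
  define q where "q = (\<Sum>u\<in>S. p u * w u)"
  have fin: "finite J" using assms finite_subset by blast
  have "avg I S p (\<lambda>c. g (c i) + h (c i) * (\<Sum>j\<in>J. w (c j)))
    = avg I S p (\<lambda>c. (g (c i) + h (c i) * w (c i)) + (\<Sum>j\<in>J - {i}. h (c i) * w (c j)))"
    using fin assms(5) by (simp add: sum.remove[of J i] algebra_simps sum_distrib_left)
  also have "\<dots> = (\<Sum>u\<in>S. p u * (g u + h u * w u))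
      + (\<Sum>j\<in>J - {i}. (\<Sum>u\<in>S. p u * h u) * (\<Sum>u\<in>S. p u * w u))"
  proof -
    have "avg I S p (\<lambda>c. h (c i) * w (c j)) = (\<Sum>u\<in>S. p u * h u) * (\<Sum>u\<in>S. p u * w u)"
      if "j \<in> J - {i}" for j
      using assms that by (intro avg_pair) auto
    moreover have "avg I S p (\<lambda>c. g (c i) + h (c i) * w (c i)) = (\<Sum>u\<in>S. p u * (g u + h u * w u))"
      using assms by (intro avg_single[where g = "\<lambda>u. g u + h u * w u"]) auto
    ultimately show ?thesis
      by (subst avg_add, subst avg_sum) simp
  qed
  also have "(\<Sum>j\<in>J - {i}. (\<Sum>u\<in>S. p u * h u) * (\<Sum>u\<in>S. p u * w u))
      = (real (card J) - 1) * ((\<Sum>u\<in>S. p u * h u) * (\<Sum>u\<in>S. p u * w u))"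
    using fin assms(5) by (simp add: card_Diff_singleton of_nat_diff Suc_leI card_gt_0_iff)
      (metis One_nat_def Suc_leI card_gt_0_iff empty_iff of_nat_1 of_nat_diff)
  finally have "avg I S p (\<lambda>c. g (c i) + h (c i) * (\<Sum>j\<in>J. w (c j)))
    = (\<Sum>u\<in>S. p u * (g u + h u * w u)) + (real (card J) - 1) * ((\<Sum>u\<in>S. p u * h u) * q)"
    by (simp only: q_def)
  then show ?thesis
    unfolding q_def[symmetric] by (simp add: algebra_simps sum.distrib sum_subtractf sum_distrib_left)
qed

text \<open>The left side is the tangent at x of the convex function \<open>v\<^sup>2 / T\<close> of
  T. The bounds by v exclude vanishing denominators unless v itself is 0.\<close>

lemma likelihood_tangent:
  fixes v T x :: real
  assumes "0 \<le> v" "v \<le> T" "v \<le> x"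
  shows "2 * v\<^sup>2 / x - v\<^sup>2 / x\<^sup>2 * T \<le> v\<^sup>2 / T"
proof (cases "v = 0")
  case False
  then have pos: "0 < v" "0 < T" "0 < x" using assms by auto
  have "2 * T * x - T\<^sup>2 \<le> x\<^sup>2"
    using zero_le_power2[of "T - x"] by (simp add: power2_eq_square algebra_simps)
  then have "2 / x - T / x\<^sup>2 \<le> 1 / T"
    using pos by (simp add: field_simps power2_eq_square)
  then have "v\<^sup>2 * (2 / x - T / x\<^sup>2) \<le> v\<^sup>2 * (1 / T)"
    by (intro mult_left_mono) auto
  then show ?thesis by (simp add: algebra_simps)
qed simp

text \<open>The averaged quantity is the success probability, for the sent index i, of a decoder
  that draws j with probability proportional to \<open>V (c j) a\<close>. Given
  \<open>c i = u\<close>, the sum over j has mean \<open>V u a + (N - 1) * out S p V a\<close>, so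
  this is Jensen's inequality for \<open>1 / T\<close>, with \<open>N - 1\<close> rounded up to
  N.\<close>

lemma avg_success:
  assumes fin: "finite I" "finite S" "finite A" and p: "\<And>u. u \<in> S \<Longrightarrow> 0 \<le> p u" "sum p S = 1"
    and V: "\<And>u a. u \<in> S \<Longrightarrow> 0 \<le> V u a" and N: "N = real (card I)" and i: "i \<in> I"
  shows "(\<Sum>u\<in>S. \<Sum>a\<in>A. p u * ((V u a)\<^sup>2 / (V u a + N * out S p V a)))
    \<le> avg I S p (\<lambda>c. \<Sum>a\<in>A. (V (c i) a)\<^sup>2 / (\<Sum>j\<in>I. V (c j) a))"
proof -
  define q where "q = out S p V"
  have q0: "0 \<le> q a" for a
    unfolding q_def out_def using p V by (intro sum_nonneg mult_nonneg_nonneg) auto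
  have N1: "1 \<le> N" using i fin by (auto simp: N card_gt_0_iff Suc_le_eq)
  define x where "x u a = V u a + N * q a" for u a
  have per: "(\<Sum>u\<in>S. p u * ((V u a)\<^sup>2 / x u a))
    \<le> avg I S p (\<lambda>c. (V (c i) a)\<^sup>2 / (\<Sum>j\<in>I. V (c j) a))" for a
  proof -
    define g where "g u = 2 * (V u a)\<^sup>2 / x u a" for u
    define h where "h u = - ((V u a)\<^sup>2 / (x u a)\<^sup>2)" for u
    have "(\<Sum>u\<in>S. p u * ((V u a)\<^sup>2 / x u a))
      \<le> (\<Sum>u\<in>S. p u * (g u + h u * (V u a + (N - 1) * (\<Sum>u'\<in>S. p u' * V u' a))))"
    proof (intro sum_mono mult_left_mono)
      fix u assume u: "u \<in> S"
      have "(\<Sum>u'\<in>S. p u' * V u' a) = q a" by (simp add: q_def out_def)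
      moreover have "(V u a)\<^sup>2 / x u a \<le> g u + h u * (V u a + (N - 1) * q a)"
      proof (cases "x u a = 0")
        case False
        then have xpos: "0 < x u a"
          using V[OF u] q0 N1 unfolding x_def by (simp add: less_le)
        have "V u a + (N - 1) * q a \<le> x u a" using q0 by (simp add: x_def algebra_simps)
        then have "(V u a)\<^sup>2 / (x u a)\<^sup>2 * (V u a + (N - 1) * q a) \<le> (V u a)\<^sup>2 / (x u a)\<^sup>2 * x u a"
          by (intro mult_left_mono) auto
        also have "\<dots> = (V u a)\<^sup>2 / x u a" using xpos by (simp add: power2_eq_square)
        finally show ?thesis by (simp add: g_def h_def)
      qed (simp add: g_def h_def)
      ultimately show "(V u a)\<^sup>2 / x u a \<le> g u + h u * (V u a + (N - 1) * (\<Sum>u'\<in>S. p u' * V u' a))"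
        by simp
    qed (use p in auto)
    also have "\<dots> = avg I S p (\<lambda>c. g (c i) + h (c i) * (\<Sum>j\<in>I. V (c j) a))"
      unfolding N using fin p i
      by (subst avg_affine[where g = g and h = h and w = "\<lambda>u. V u a"]) auto
    also have "\<dots> \<le> avg I S p (\<lambda>c. (V (c i) a)\<^sup>2 / (\<Sum>j\<in>I. V (c j) a))"
    proof (rule avg_mono)
      fix c assume c: "c \<in> PiE I (\<lambda>_. S)"
      then have cS: "c j \<in> S" if "j \<in> I" for j using that by auto
      have "2 * (V (c i) a)\<^sup>2 / x (c i) a - (V (c i) a)\<^sup>2 / (x (c i) a)\<^sup>2 * (\<Sum>j\<in>I. V (c j) a)
        \<le> (V (c i) a)\<^sup>2 / (\<Sum>j\<in>I. V (c j) a)"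
        using V cS i fin q0 N1
        by (intro likelihood_tangent) (auto simp: x_def intro!: member_le_sum[where f = "\<lambda>j. V (c j) a"])
      then show "g (c i) + h (c i) * (\<Sum>j\<in>I. V (c j) a) \<le> (V (c i) a)\<^sup>2 / (\<Sum>j\<in>I. V (c j) a)"
        by (simp add: g_def h_def)
    qed (use p in auto)
    finally show ?thesis .
  qed
  have "(\<Sum>u\<in>S. \<Sum>a\<in>A. p u * ((V u a)\<^sup>2 / x u a)) = (\<Sum>a\<in>A. \<Sum>u\<in>S. p u * ((V u a)\<^sup>2 / x u a))"
    by (rule sum.swap)
  also have "\<dots> \<le> (\<Sum>a\<in>A. avg I S p (\<lambda>c. (V (c i) a)\<^sup>2 / (\<Sum>j\<in>I. V (c j) a)))"
    by (intro sum_mono per)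
  finally show ?thesis by (simp add: avg_sum x_def q_def)
qed

lemma ln_tangent:
  fixes x y :: real
  assumes "0 < x" "0 < y"
  shows "ln y \<le> ln x + (y - x) / x"
proof -
  have "ln (y / x) \<le> y / x - 1" using assms by (intro ln_le_minus_one) simp
  then show ?thesis using assms by (simp add: ln_div diff_divide_distrib)
qed

text \<open>Soft covering: given its own codeword, the other codewords of the row look like the output law.\<close>

lemma avg_leakage:
  assumes fin: "finite I" "finite S" "finite A" and p: "\<And>u. u \<in> S \<Longrightarrow> 0 < p u" "sum p S = 1"
    and V: "\<And>u a. u \<in> S \<Longrightarrow> 0 \<le> V u a" and J: "J \<subseteq> I" "i \<in> J" and L: "L = real (card J)"
  shows "avg I S p (\<lambda>c. \<Sum>a\<in>A. V (c i) a * ln ((\<Sum>j\<in>J. V (c j) a) / (L * out S p V a)))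
    \<le> (\<Sum>u\<in>S. \<Sum>a\<in>A. p u * (V u a * ln (1 + V u a / (L * out S p V a))))"
proof -
  define q where "q = out S p V"
  have finJ: "finite J" using fin J finite_subset by blast
  have iI: "i \<in> I" using J by auto
  have q0: "0 \<le> q a" for a
    unfolding q_def out_def using p V by (intro sum_nonneg mult_nonneg_nonneg) (auto simp: less_imp_le)
  have qpos: "0 < q a" if "u \<in> S" "0 < V u a" for u a
  proof -
    have "0 < p u * V u a" using that p by simp
    also have "\<dots> \<le> q a" unfolding q_def out_def
      using that fin p V by (intro member_le_sum[where f = "\<lambda>u. p u * V u a"]) (auto simp: less_imp_le)
    finally show ?thesis .
  qed
  have L1: "1 \<le> L" using J finJ by (auto simp: L card_gt_0_iff Suc_le_eq)
  \<comment> \<open>Tangent point for the logarithm. The row sum divided by \<open>L * q a\<close>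
    has conditional mean \<open>(V u a + (L - 1) * q a) / (L * q a)\<close>, which is at most this
    value.\<close>
  define x where "x u a = 1 + V u a / (L * q a)" for u a
  have xpos: "0 < x u a" if "u \<in> S" for u a
    using V[OF that, of a] q0[of a] L1 unfolding x_def by (intro add_pos_nonneg) auto
  have per: "avg I S p (\<lambda>c. V (c i) a * ln ((\<Sum>j\<in>J. V (c j) a) / (L * q a)))
      \<le> (\<Sum>u\<in>S. p u * (V u a * ln (x u a)))" for a
  proof -
    define g where "g u = V u a * (ln (x u a) - 1)" for u
    define h where "h u = V u a / (x u a * (L * q a))" for u
    have "avg I S p (\<lambda>c. V (c i) a * ln ((\<Sum>j\<in>J. V (c j) a) / (L * q a)))
      \<le> avg I S p (\<lambda>c. g (c i) + h (c i) * (\<Sum>j\<in>J. V (c j) a))"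
    proof (rule avg_mono)
      fix c assume c: "c \<in> PiE I (\<lambda>_. S)"
      then have cS: "c j \<in> S" if "j \<in> I" for j using that by auto
      define T where "T = (\<Sum>j\<in>J. V (c j) a)"
      have VT: "V (c i) a \<le> T" unfolding T_def
        using J finJ V cS by (intro member_le_sum[where f = "\<lambda>j. V (c j) a"]) auto
      show "V (c i) a * ln (T / (L * q a)) \<le> g (c i) + h (c i) * T"
      proof (cases "V (c i) a = 0")
        case False
        then have v: "0 < V (c i) a" using V[OF cS[OF iI], of a] by simp
        have qp: "0 < q a" using qpos[OF cS[OF iI] v] .
        have "ln (T / (L * q a)) \<le> ln (x (c i) a) + (T / (L * q a) - x (c i) a) / x (c i) a"
          using v VT qp L1 xpos[OF cS[OF iI]] by (intro ln_tangent) auto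
        then have "V (c i) a * ln (T / (L * q a))
           \<le> V (c i) a * (ln (x (c i) a) + (T / (L * q a) - x (c i) a) / x (c i) a)"
          using v by (intro mult_left_mono) auto
        also have "\<dots> = g (c i) + h (c i) * T"
          using xpos[OF cS[OF iI], of a] by (simp add: g_def h_def field_simps)
        finally show ?thesis .
      qed (simp add: g_def h_def)
    qed (use p in \<open>auto simp: less_imp_le\<close>)
    also have "\<dots> = (\<Sum>u\<in>S. p u * (g u + h u * (V u a + (L - 1) * (\<Sum>u'\<in>S. p u' * V u' a))))"
      unfolding L using fin p J
      by (subst avg_affine[where g = g and h = h and w = "\<lambda>u. V u a"]) auto
    also have "\<dots> \<le> (\<Sum>u\<in>S. p u * (V u a * ln (x u a)))"
    proof (intro sum_mono mult_left_mono)
      fix u assume u: "u \<in> S"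
      have "(\<Sum>u'\<in>S. p u' * V u' a) = q a" by (simp add: q_def out_def)
      moreover have "g u + h u * (V u a + (L - 1) * q a) \<le> V u a * ln (x u a)"
      proof (cases "V u a = 0")
        case False
        then have v: "0 < V u a" using V[OF u, of a] by simp
        have qp: "0 < q a" using qpos[OF u v] .
        have "V u a + (L - 1) * q a \<le> x u a * (L * q a)"
          using qp L1 v by (simp add: x_def field_simps)
        then have "h u * (V u a + (L - 1) * q a) \<le> h u * (x u a * (L * q a))"
          using v xpos[OF u, of a] qp L1 by (intro mult_left_mono) (auto simp: h_def)
        also have "\<dots> = V u a"
          using xpos[OF u, of a] qp L1 by (simp add: h_def)
        finally show ?thesis by (simp add: g_def algebra_simps)
      qed (simp add: g_def h_def)
      ultimately show "g u + h u * (V u a + (L - 1) * (\<Sum>u'\<in>S. p u' * V u' a)) \<le> V u a * ln (x u a)"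
        by simp
    qed (use p in \<open>auto simp: less_imp_le\<close>)
    finally show ?thesis .
  qed
  have "avg I S p (\<lambda>c. \<Sum>a\<in>A. V (c i) a * ln ((\<Sum>j\<in>J. V (c j) a) / (L * q a)))
    \<le> (\<Sum>a\<in>A. \<Sum>u\<in>S. p u * (V u a * ln (x u a)))"
    unfolding avg_sum by (intro sum_mono per)
  also have "\<dots> = (\<Sum>u\<in>S. \<Sum>a\<in>A. p u * (V u a * ln (x u a)))"
    by (rule sum.swap)
  finally show ?thesis by (simp add: x_def q_def)
qed

lemma avg_exists_le:
  assumes "finite I" "finite S" "sum p S = 1" "\<And>u. u \<in> S \<Longrightarrow> 0 < p u" "avg I S p X \<le> e"
  shows "\<exists>c\<in>PiE I (\<lambda>_. S). X c \<le> e"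
proof (rule ccontr)
  assume "\<not> ?thesis"
  then have *: "e < X c" if "c \<in> PiE I (\<lambda>_. S)" for c using that by force
  have "S \<noteq> {}" using assms(3) by auto
  then have "avg I S p (\<lambda>c. e) < avg I S p X"
    unfolding avg_def using assms *
    by (intro sum_strict_mono mult_strict_left_mono prod_pos finite_PiE) (auto simp: PiE_eq_empty_iff)
  then show False using assms avg_const[of I S p e] by simp
qed

text \<open>Error and leakage enter one functional because a single codebook has to be good for
  both. The entries form an array whose row is the message and whose column is local randomness, so
  decoding compares all of I while leakage sums over one row.\<close>

lemma random_codebook:
  fixes M L :: nat
  defines "I \<equiv> {..<M} \<times> {..<L}" and "N \<equiv> real (M * L)"
  assumes fin: "finite S" "finite A" "finite B" and p: "\<And>u. u \<in> S \<Longrightarrow> 0 < p u" "sum p S = 1"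
    and VA: "\<And>u a. u \<in> S \<Longrightarrow> 0 \<le> VA u a" and VB: "\<And>u b. u \<in> S \<Longrightarrow> 0 \<le> VB u b"
    and ge1: "1 \<le> M" "1 \<le> L" and \<kappa>: "0 \<le> \<kappa>"
  shows "\<exists>c\<in>PiE I (\<lambda>_. S).
      1 - (\<Sum>i\<in>I. \<Sum>a\<in>A. (VA (c i) a)\<^sup>2 / (\<Sum>j\<in>I. VA (c j) a)) / N
      + \<kappa> * ((\<Sum>i\<in>I. \<Sum>b\<in>B. VB (c i) b *
           ln ((\<Sum>j\<in>{fst i} \<times> {..<L}. VB (c j) b) / (real L * out S p VB b))) / N)
      \<le> 1 - (\<Sum>u\<in>S. \<Sum>a\<in>A. p u * ((VA u a)\<^sup>2 / (VA u a + N * out S p VA a)))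
      + \<kappa> * (\<Sum>u\<in>S. \<Sum>b\<in>B. p u * (VB u b * ln (1 + VB u b / (real L * out S p VB b))))"
proof (rule avg_exists_le)
  have finI: "finite I" by (simp add: I_def)
  have N: "N = real (card I)" by (simp add: I_def N_def)
  have N0: "0 < N" using ge1 by (simp add: N_def)
  define s where "s = (\<Sum>u\<in>S. \<Sum>a\<in>A. p u * ((VA u a)\<^sup>2 / (VA u a + N * out S p VA a)))"
  define t where "t = (\<Sum>u\<in>S. \<Sum>b\<in>B. p u * (VB u b * ln (1 + VB u b / (real L * out S p VB b))))"
  define X where "X i c = (\<Sum>a\<in>A. (VA (c i) a)\<^sup>2 / (\<Sum>j\<in>I. VA (c j) a))" for i :: "nat \<times> nat" and c
  define Y where "Y i c = (\<Sum>b\<in>B. VB (c i) b *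
           ln ((\<Sum>j\<in>{fst i} \<times> {..<L}. VB (c j) b) / (real L * out S p VB b)))" for i :: "nat \<times> nat" and c
  have X: "s \<le> avg I S p (X i)" if "i \<in> I" for i
    unfolding s_def X_def using fin finI p VA N that
    by (intro avg_success) (auto simp: less_imp_le)
  have Y: "avg I S p (Y i) \<le> t" if "i \<in> I" for i
    unfolding t_def Y_def using fin finI p VB that
    by (intro avg_leakage) (auto simp: I_def)
  have "avg I S p (\<lambda>c. 1 - (\<Sum>i\<in>I. X i c) / N + \<kappa> * ((\<Sum>i\<in>I. Y i c) / N))
     = 1 - (\<Sum>i\<in>I. avg I S p (X i)) / N + \<kappa> * ((\<Sum>i\<in>I. avg I S p (Y i)) / N)"
    using avg_cmult[of I S p "1 / N" "\<lambda>c. \<Sum>i\<in>I. X i c"]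
      avg_cmult[of I S p "\<kappa> / N" "\<lambda>c. \<Sum>i\<in>I. Y i c"] finI fin p
    by (simp add: avg_add avg_diff avg_const avg_sum)
  also have "\<dots> \<le> 1 - (\<Sum>i\<in>I. s) / N + \<kappa> * ((\<Sum>i\<in>I. t) / N)"
    using X Y N0 \<kappa>
    by (intro add_mono diff_mono mult_left_mono divide_right_mono sum_mono) auto
  also have "\<dots> = 1 - s + \<kappa> * t" using N0 by (simp add: N)
  finally show "avg I S p (\<lambda>c. 1 - (\<Sum>i\<in>I. \<Sum>a\<in>A. (VA (c i) a)\<^sup>2 / (\<Sum>j\<in>I. VA (c j) a)) / N
      + \<kappa> * ((\<Sum>i\<in>I. \<Sum>b\<in>B. VB (c i) b *
           ln ((\<Sum>j\<in>{fst i} \<times> {..<L}. VB (c j) b) / (real L * out S p VB b))) / N))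
      \<le> 1 - (\<Sum>u\<in>S. \<Sum>a\<in>A. p u * ((VA u a)\<^sup>2 / (VA u a + N * out S p VA a)))
      + \<kappa> * (\<Sum>u\<in>S. \<Sum>b\<in>B. p u * (VB u b * ln (1 + VB u b / (real L * out S p VB b))))"
    by (simp only: X_def Y_def s_def t_def)
qed (use fin p in \<open>auto simp: I_def\<close>)

section \<open>From a codebook to a wiretap code, in one shot\<close>

lemma mutual_info_MZ_eq:
  "mutual_info_MZ W n K phi = (\<Sum>m<K. \<Sum>zs\<in>seqs n. p_MZ W n K phi m zs *
     ln (p_MZ W n K phi m zs / ((1 / real K) * p_Z W n K phi zs)))"
  unfolding mutual_info_MZ_def by (intro sum.cong refl) auto

lemma p_MZ_nonneg:
  assumes "is_channel W" "is_code n K phi psi" "m < K" "zs \<in> seqs n"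
  shows "0 \<le> p_MZ W n K phi m zs"
  using assms by (auto simp: p_MZ_eq is_code_def intro!: divide_nonneg_nonneg outch_nonneg stochastic_margZ)

lemma p_MZ_le_p_Z:
  assumes "is_channel W" "is_code n K phi psi" "m < K" "zs \<in> seqs n"
  shows "p_MZ W n K phi m zs \<le> p_Z W n K phi zs"
  unfolding p_Z_def using assms
  by (intro member_le_sum[where f = "\<lambda>m. p_MZ W n K phi m zs"]) (auto intro: p_MZ_nonneg)

lemma p_Z_nonneg:
  assumes "is_channel W" "is_code n K phi psi" "zs \<in> seqs n"
  shows "0 \<le> p_Z W n K phi zs"
  unfolding p_Z_def using assms by (intro sum_nonneg) (auto intro: p_MZ_nonneg)

lemma sum_p_MZ:
  assumes "is_channel W" "is_code n K phi psi" "m < K"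
  shows "(\<Sum>zs\<in>seqs n. p_MZ W n K phi m zs) = 1 / real K"
proof -
  have "(\<Sum>zs\<in>seqs n. p_MZ W n K phi m zs) = (1 / real K) * (\<Sum>zs\<in>seqs n. outch phi (margZ W) n m zs)"
    by (simp add: p_MZ_eq sum_distrib_left)
  then show ?thesis using assms by (simp add: sum_outch stochastic_margZ is_code_def)
qed

lemma sum_p_Z:
  assumes "is_channel W" "is_code n K phi psi"
  shows "(\<Sum>zs\<in>seqs n. p_Z W n K phi zs) = 1"
proof -
  have "(\<Sum>zs\<in>seqs n. p_Z W n K phi zs) = (\<Sum>m<K. \<Sum>zs\<in>seqs n. p_MZ W n K phi m zs)"
    unfolding p_Z_def by (rule sum.swap)
  also have "\<dots> = (\<Sum>m<K. 1 / real K)" using assms by (intro sum.cong) (auto simp: sum_p_MZ)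
  finally show ?thesis using assms by (simp add: is_code_def)
qed

lemma mutual_info_MZ_nonneg:
  assumes "is_channel W" "is_code n K phi psi"
  shows "0 \<le> mutual_info_MZ W n K phi"
proof -
  have K: "0 < real K" using assms by (simp add: is_code_def)
  have "0 \<le> (\<Sum>x\<in>{..<K} \<times> seqs n. (case x of (m, zs) \<Rightarrow> p_MZ W n K phi m zs) *
     ln ((case x of (m, zs) \<Rightarrow> p_MZ W n K phi m zs) / (case x of (m, zs) \<Rightarrow> (1 / real K) * p_Z W n K phi zs)))"
  proof (rule gibbs)
    show "(\<Sum>x\<in>{..<K} \<times> seqs n. case x of (m, zs) \<Rightarrow> (1 / real K) * p_Z W n K phi zs)
       \<le> (\<Sum>x\<in>{..<K} \<times> seqs n. case x of (m, zs) \<Rightarrow> p_MZ W n K phi m zs)"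
      using assms K by (simp add: sum_p_MZ sum_p_Z flip: sum.cartesian_product sum_divide_distrib)
    show "(case x of (m, zs) \<Rightarrow> p_MZ W n K phi m zs) = 0"
      if "x \<in> {..<K} \<times> seqs n" "(case x of (m, zs) \<Rightarrow> (1 / real K) * p_Z W n K phi zs) = 0" for x
      using that K p_MZ_nonneg[OF assms] p_MZ_le_p_Z[OF assms] by (fastforce intro: antisym)
  qed (use assms K in \<open>auto intro!: p_MZ_nonneg p_Z_nonneg divide_nonneg_nonneg\<close>)
  then show ?thesis by (simp add: mutual_info_MZ_eq sum.cartesian_product case_prod_unfold)
qed

lemma prob_correct_le_1:
  assumes "is_channel W" "is_code n K phi psi"
  shows "prob_correct W n K phi psi \<le> 1"
proof -
  have K: "0 < real K" using assms by (simp add: is_code_def)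
  have nn: "0 \<le> outch phi (margY W) n m ys" if "m < K" for m ys
    using assms that by (auto simp: is_code_def intro!: outch_nonneg stochastic_margY)
  have "(\<Sum>ys\<in>seqs n. outch phi (margY W) n (psi ys) ys)
      \<le> (\<Sum>ys\<in>seqs n. \<Sum>m<K. outch phi (margY W) n m ys)"
    using assms nn by (intro sum_mono member_le_sum) (auto simp: is_code_def)
  also have "\<dots> = (\<Sum>m<K. \<Sum>ys\<in>seqs n. outch phi (margY W) n m ys)"
    by (rule sum.swap)
  also have "\<dots> = real K"
    using assms by (simp add: sum_outch stochastic_margY is_code_def)
  finally show ?thesis using K by (simp add: prob_correct_eq[OF assms(2)])
qed

lemma sum_out:
  assumes "sum p S = 1" "\<And>u. u \<in> S \<Longrightarrow> (\<Sum>a\<in>A. v u a) = 1"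
  shows "(\<Sum>a\<in>A. out S p v a) = 1"
proof -
  have "(\<Sum>a\<in>A. out S p v a) = (\<Sum>u\<in>S. p u * (\<Sum>a\<in>A. v u a))"
    unfolding out_def by (subst sum.swap) (simp add: sum_distrib_left)
  then show ?thesis using assms by simp
qed

lemma out_nonneg:
  assumes "\<And>u. u \<in> S \<Longrightarrow> 0 \<le> p u" "\<And>u. u \<in> S \<Longrightarrow> 0 \<le> v u a"
  shows "0 \<le> out S p v a"
  unfolding out_def using assms by (intro sum_nonneg mult_nonneg_nonneg) auto

lemma out_pos:
  assumes "finite S" "\<And>u. u \<in> S \<Longrightarrow> 0 < p u" "\<And>u. u \<in> S \<Longrightarrow> 0 \<le> v u a" "u \<in> S" "0 < v u a"
  shows "0 < out S p v a"
proof -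
  have "0 < p u * v u a" using assms by simp
  also have "\<dots> \<le> out S p v a" unfolding out_def
    using assms by (intro member_le_sum[where f = "\<lambda>u. p u * v u a"]) (auto simp: less_imp_le)
  finally show ?thesis .
qed

text \<open>The encoder draws a column uniformly and passes the codeword through F. Two comparisons
  lead from the codebook functional to the code: maximum likelihood over rows does at least as well
  as the randomised decoder, and measuring the eavesdropper's output against the target law
  \<open>out S p (VB F)\<close> instead of its true law can only increase the leakage.\<close>

lemma wiretap_one_shot:
  fixes W :: "'x::finite \<Rightarrow> 'y::finite \<Rightarrow> 'z::finite \<Rightarrow> real" and n M L :: nat
  defines "VA \<equiv> \<lambda>F. outch F (margY W) n" and "VB \<equiv> \<lambda>F. outch F (margZ W) n"
  assumes W: "is_channel W" and S: "finite S"
    and p: "\<And>u. u \<in> S \<Longrightarrow> 0 < p u" "sum p S = 1"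
    and F: "\<And>u xs. u \<in> S \<Longrightarrow> 0 \<le> F u xs" "\<And>u. u \<in> S \<Longrightarrow> (\<Sum>xs\<in>seqs n. F u xs) = 1"
    and ge1: "1 \<le> M" "1 \<le> L" and \<kappa>: "0 \<le> \<kappa>"
  shows "\<exists>phi psi. is_code n M phi psi \<and> prob_error W n M phi psi + \<kappa> * mutual_info_MZ W n M phi
      \<le> 1 - (\<Sum>u\<in>S. \<Sum>a\<in>seqs n. p u * ((VA F u a)\<^sup>2 / (VA F u a + real (M * L) * out S p (VA F) a)))
      + \<kappa> * (\<Sum>u\<in>S. \<Sum>b\<in>seqs n. p u * (VB F u b * ln (1 + VB F u b / (real L * out S p (VB F) b))))"
    (is "\<exists>phi psi. _ \<and> _ \<le> ?rhs")
proof -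
  have VA0: "0 \<le> VA F u a" and VB0: "0 \<le> VB F u b" if "u \<in> S" for u a b
    using that W F unfolding VA_def VB_def
    by (auto intro!: outch_nonneg stochastic_margY stochastic_margZ)
  define I where "I = {..<M} \<times> {..<L}"
  define N where "N = real (M * L)"
  obtain c where cI: "c \<in> PiE I (\<lambda>_. S)" and c: "1 - (\<Sum>i\<in>I. \<Sum>a\<in>seqs n. (VA F (c i) a)\<^sup>2 / (\<Sum>j\<in>I. VA F (c j) a)) / N
      + \<kappa> * ((\<Sum>i\<in>I. \<Sum>b\<in>seqs n. VB F (c i) b *
           ln ((\<Sum>j\<in>{fst i} \<times> {..<L}. VB F (c j) b) / (real L * out S p (VB F) b))) / N) \<le> ?rhs"
    using random_codebook[of S "seqs n" "seqs n" p "VA F" "VB F" M L \<kappa>] S p VA0 VB0 ge1 \<kappa>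
    unfolding I_def N_def by auto
  have cS: "c (m, l) \<in> S" if "m < M" "l < L" for m l
    using cI that by (auto simp: I_def)
  define phi where "phi m xs = (\<Sum>l<L. F (c (m, l)) xs) / real L" for m xs
  define s where "s m ys = (\<Sum>l<L. VA F (c (m, l)) ys)" for m ys
  define psi where "psi ys = (SOME m. m < M \<and> (\<forall>m'<M. s m' ys \<le> s m ys))" for ys
  have psi: "psi ys < M \<and> (\<forall>m'<M. s m' ys \<le> s (psi ys) ys)" for ys
  proof -
    have "Max ((\<lambda>m. s m ys) ` {..<M}) \<in> (\<lambda>m. s m ys) ` {..<M}"
      using ge1 by (intro Max_in) (auto simp: lessThan_empty_iff)
    then obtain m where "m < M" "s m ys = Max ((\<lambda>m. s m ys) ` {..<M})" by auto
    then have "\<exists>m. m < M \<and> (\<forall>m'<M. s m' ys \<le> s m ys)"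
      by (intro exI[of _ m]) auto
    then show ?thesis unfolding psi_def by (rule someI_ex)
  qed
  have phi_sum: "(\<Sum>xs\<in>seqs n. phi m xs) = 1" if "m < M" for m
  proof -
    have "(\<Sum>xs\<in>seqs n. phi m xs) = (\<Sum>l<L. \<Sum>xs\<in>seqs n. F (c (m, l)) xs) / real L"
      unfolding phi_def by (subst sum.swap) (simp add: sum_divide_distrib)
    then show ?thesis using F cS that ge1 by simp
  qed
  have code: "is_code n M phi psi"
    using ge1 psi phi_sum F cS by (auto simp: is_code_def phi_def intro!: divide_nonneg_nonneg sum_nonneg)
  have outch_phi: "outch phi V n m ys = (\<Sum>l<L. outch F V n (c (m, l)) ys) / real L"
    for V :: "'x \<Rightarrow> 'b \<Rightarrow> real" and m ys
  proof -
    have "(\<Sum>l<L. outch F V n (c (m, l)) ys) = (\<Sum>xs\<in>seqs n. \<Sum>l<L. F (c (m, l)) xs * wn V xs ys)"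
      unfolding outch_def by (rule sum.swap)
    then show ?thesis by (simp add: outch_def phi_def sum_divide_distrib sum_distrib_right)
  qed
  have "(\<Sum>i\<in>I. \<Sum>a\<in>seqs n. (VA F (c i) a)\<^sup>2 / (\<Sum>j\<in>I. VA F (c j) a)) / N \<le> prob_correct W n M phi psi"
  proof -
    \<comment> \<open>Each single likelihood is at most the largest row likelihood, and the weights
      \<open>VA F (c i) a / T\<close> sum to 1 unless T is 0.\<close>
    have "(\<Sum>i\<in>I. (VA F (c i) a)\<^sup>2 / (\<Sum>j\<in>I. VA F (c j) a)) \<le> s (psi a) a" for a
    proof -
      define T where "T = (\<Sum>j\<in>I. VA F (c j) a)"
      have T0: "0 \<le> T" unfolding T_def using VA0 cS by (intro sum_nonneg) (auto simp: I_def)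
      have s0: "0 \<le> s (psi a) a" unfolding s_def using VA0 cS psi by (intro sum_nonneg) auto
      have "VA F (c i) a \<le> s (psi a) a" if iI: "i \<in> I" for i
      proof -
        obtain m l where i: "i = (m, l)" "m < M" "l < L" using iI by (auto simp: I_def)
        have "VA F (c i) a \<le> s m a" unfolding i s_def using VA0 cS i
          by (intro member_le_sum[where f = "\<lambda>l. VA F (c (m, l)) a"]) auto
        also have "s m a \<le> s (psi a) a" using psi[of a] i by blast
        finally show ?thesis .
      qed
      then have "(\<Sum>i\<in>I. (VA F (c i) a)\<^sup>2 / T) \<le> (\<Sum>i\<in>I. VA F (c i) a * s (psi a) a / T)"
        using VA0 cS T0 unfolding power2_eq_square
        by (intro sum_mono divide_right_mono mult_left_mono) (auto simp: I_def)
      also have "\<dots> = T * s (psi a) a / T"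
        unfolding T_def by (simp add: sum_divide_distrib sum_distrib_right)
      also have "\<dots> \<le> s (psi a) a" using s0 by (cases "T = 0") auto
      finally show ?thesis by (simp add: T_def)
    qed
    then have "(\<Sum>a\<in>seqs n. \<Sum>i\<in>I. (VA F (c i) a)\<^sup>2 / (\<Sum>j\<in>I. VA F (c j) a)) / N \<le> (\<Sum>a\<in>seqs n. s (psi a) a) / N"
      by (intro divide_right_mono sum_mono) (auto simp: N_def)
    also have "\<dots> = prob_correct W n M phi psi"
      by (simp add: prob_correct_eq[OF code] outch_phi s_def VA_def N_def sum_divide_distrib mult.commute)
    finally show ?thesis by (subst sum.swap)
  qed
  moreover have "mutual_info_MZ W n M phi \<le> (\<Sum>i\<in>I. \<Sum>b\<in>seqs n. VB F (c i) b *
           ln ((\<Sum>j\<in>{fst i} \<times> {..<L}. VB F (c j) b) / (real L * out S p (VB F) b))) / N"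
  proof -
    define q where "q = out S p (VB F)"
    define P where "P = p_MZ W n M phi"
    define PZ where "PZ = p_Z W n M phi"
    have P_eq: "P m b = (\<Sum>l<L. VB F (c (m, l)) b) / N" if "b \<in> seqs n" for m b
      using that by (simp add: P_def p_MZ_eq outch_phi VB_def N_def field_simps)
    have N0: "0 < N" using ge1 by (simp add: N_def)
    have P0: "0 \<le> P m b" and PZ: "P m b \<le> PZ b" "0 \<le> PZ b" if "m < M" "b \<in> seqs n" for m b
      using that p_MZ_nonneg[OF W code] p_MZ_le_p_Z[OF W code] p_Z_nonneg[OF W code]
      unfolding P_def PZ_def by auto
    have qP: "0 < q b" if mb: "m < M" "b \<in> seqs n" "0 < P m b" for m b
    proof -
      have "0 < (\<Sum>l<L. VB F (c (m, l)) b)" using mb N0 by (simp add: P_eq zero_less_divide_iff)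
      then obtain l where "l < L" "0 < VB F (c (m, l)) b"
        by (metis lessThan_iff not_le sum_nonpos)
      then show ?thesis unfolding q_def using S p VB0 cS mb
        by (intro out_pos[where u = "c (m, l)"]) auto
    qed
    have q0: "0 \<le> q b" for b
      unfolding q_def using p VB0 by (intro out_nonneg) (auto simp: less_imp_le)
    have "(\<Sum>i\<in>I. \<Sum>b\<in>seqs n. VB F (c i) b *
           ln ((\<Sum>j\<in>{fst i} \<times> {..<L}. VB F (c j) b) / (real L * q b))) / N
      = (\<Sum>m<M. \<Sum>b\<in>seqs n. P m b * ln (real M * P m b / q b))"
    proof -
      have row: "(\<Sum>j\<in>{m} \<times> {..<L}. VB F (c j) b) = (\<Sum>l<L. VB F (c (m, l)) b)" for m b
        by (simp add: sum.cartesian_product')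
      have "(\<Sum>i\<in>I. \<Sum>b\<in>seqs n. VB F (c i) b *
           ln ((\<Sum>j\<in>{fst i} \<times> {..<L}. VB F (c j) b) / (real L * q b)))
        = (\<Sum>m<M. \<Sum>l<L. \<Sum>b\<in>seqs n. VB F (c (m, l)) b *
           ln ((\<Sum>l<L. VB F (c (m, l)) b) / (real L * q b)))"
        unfolding I_def by (simp add: sum.cartesian_product' row)
      also have "\<dots> = (\<Sum>m<M. \<Sum>b\<in>seqs n. (\<Sum>l<L. VB F (c (m, l)) b) *
           ln ((\<Sum>l<L. VB F (c (m, l)) b) / (real L * q b)))"
        unfolding sum_distrib_right by (intro sum.cong refl sum.swap)
      also have "\<dots> = (\<Sum>m<M. \<Sum>b\<in>seqs n. (N * P m b) * ln (real M * P m b / q b))"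
        using N0 ge1 by (intro sum.cong refl arg_cong2[where f = "(*)"] arg_cong[where f = ln])
          (auto simp: P_eq N_def field_simps)
      finally show ?thesis using N0 by (simp add: sum_divide_distrib)
    qed
    \<comment> \<open>This divergence of the true output law from the target law is exactly the
      excess over the mutual information, by the chain rule shown next.\<close>
    moreover have "0 \<le> (\<Sum>b\<in>seqs n. PZ b * ln (PZ b / q b))"
    proof (rule gibbs)
      show "PZ b = 0" if b: "b \<in> seqs n" "q b = 0" for b
      proof -
        have "P m b = 0" if "m < M" for m
          using qP[OF that b(1)] P0[OF that b(1)] b(2) by force
        then show ?thesis by (simp add: PZ_def p_Z_def P_def)
      qed
      have "sum q (seqs n) = 1" unfolding q_def
        using p F W by (intro sum_out) (auto simp: VB_def sum_outch stochastic_margZ)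
      then show "sum q (seqs n) \<le> sum PZ (seqs n)"
        using sum_p_Z[OF W code] by (simp add: PZ_def)
    qed (use PZ(2) ge1 q0 in auto)
    moreover have "(\<Sum>m<M. \<Sum>b\<in>seqs n. P m b * ln (real M * P m b / q b))
      = mutual_info_MZ W n M phi + (\<Sum>b\<in>seqs n. PZ b * ln (PZ b / q b))"
    proof -
      have "(\<Sum>b\<in>seqs n. PZ b * ln (PZ b / q b)) = (\<Sum>m<M. \<Sum>b\<in>seqs n. P m b * ln (PZ b / q b))"
        by (subst sum.swap) (simp add: PZ_def p_Z_def P_def sum_distrib_right)
      moreover have "P m b * ln (real M * P m b / q b)
         = P m b * ln (P m b / ((1 / real M) * PZ b)) + P m b * ln (PZ b / q b)"
        if "m < M" "b \<in> seqs n" for m b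
      proof (cases "P m b = 0")
        case False
        then have "0 < P m b" "0 < PZ b" "0 < q b" "0 < real M"
          using P0[OF that] PZ[OF that] qP[OF that] ge1 by auto
        then show ?thesis by (simp add: ln_div ln_mult algebra_simps)
      qed simp
      ultimately show ?thesis
        unfolding mutual_info_MZ_eq P_def[symmetric] PZ_def[symmetric] by (simp flip: sum.distrib)
    qed
    ultimately show ?thesis by (simp add: q_def)
  qed
  ultimately have "prob_error W n M phi psi + \<kappa> * mutual_info_MZ W n M phi \<le> ?rhs"
    using \<kappa> by (intro order.trans[OF _ c] add_mono mult_left_mono) (auto simp: prob_error_def)
  then show ?thesis using code by blast
qed

section \<open>Concatenated blocks\<close>

text \<open>The \<open>r\<close> padding letters make every code length reachable from the fixed inner block length \<open>n\<close>.\<close>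

fun blockenc :: "'x \<Rightarrow> nat \<Rightarrow> nat \<Rightarrow> ('u \<Rightarrow> 'x list \<Rightarrow> real) \<Rightarrow> 'u list \<Rightarrow> 'x list \<Rightarrow> real" where
  "blockenc x0 n r f [] xs = (if xs = replicate r x0 then 1 else 0)"
| "blockenc x0 n r f (u # us) xs = f u (take n xs) * blockenc x0 n r f us (drop n xs)"

lemma words_Suc_iff: "us \<in> words S (Suc k) \<longleftrightarrow> (\<exists>u us'. us = u # us' \<and> u \<in> S \<and> us' \<in> words S k)"
  by (auto simp: words_def length_Suc_conv)

text \<open>Interpreted twice, for the receiver's and for the eavesdropper's marginal, so that one
  second-moment computation serves both bounds.\<close>

locale block_channel =
  fixes S :: "'u set" and p :: "'u \<Rightarrow> real" and f :: "'u \<Rightarrow> 'x::finite list \<Rightarrow> real"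
    and V :: "'x \<Rightarrow> 'y::finite \<Rightarrow> real" and n r :: nat and x0 :: 'x
  assumes finS: "finite S" and p_pos: "u \<in> S \<Longrightarrow> 0 < p u" and p_sum: "sum p S = 1"
    and f_nonneg: "u \<in> S \<Longrightarrow> 0 \<le> f u xs" and f_sum: "u \<in> S \<Longrightarrow> (\<Sum>xs\<in>seqs n. f u xs) = 1"
    and V: "stochastic V"
begin

definition pk :: "'u list \<Rightarrow> real" where "pk us = prod_list (map p us)"
definition v :: "'u \<Rightarrow> 'y list \<Rightarrow> real" where "v = outch f V n"
definition vk :: "nat \<Rightarrow> 'u list \<Rightarrow> 'y list \<Rightarrow> real" where
  "vk k = outch (blockenc x0 n r f) V (n * k + r)"
definition qk :: "nat \<Rightarrow> 'y list \<Rightarrow> real" where "qk k = out (words S k) pk (vk k)"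
definition \<mu> :: real where "\<mu> = minfo S p v (seqs n)"
definition d1 :: "'u \<Rightarrow> 'y list \<Rightarrow> real" where "d1 u a = ln (v u a / out S p v a) - \<mu>"
text \<open>Centred information density of k blocks, a sum of k independent copies of
  \<open>d1\<close>. The padding output has the same law under \<open>vk\<close> and
  \<open>qk\<close> and cancels from the quotient.\<close>

definition dk :: "nat \<Rightarrow> 'u list \<Rightarrow> 'y list \<Rightarrow> real" where
  "dk k us b = ln (vk k us b / qk k b) - real k * \<mu>"
definition \<sigma>2 :: real where "\<sigma>2 = (\<Sum>u\<in>S. \<Sum>a\<in>seqs n. p u * v u a * (d1 u a)\<^sup>2)"
definition E :: "nat \<Rightarrow> ('u list \<Rightarrow> 'y list \<Rightarrow> real) \<Rightarrow> real" where
  "E k G = (\<Sum>us\<in>words S k. \<Sum>b\<in>seqs (n * k + r). pk us * vk k us b * G us b)"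

lemma pk_pos: "us \<in> words S k \<Longrightarrow> 0 < pk us"
  unfolding pk_def by (induction us arbitrary: k) (auto simp: words_def p_pos)

lemma pk_sum: "sum pk (words S k) = 1"
proof (induction k)
  case (Suc k)
  then show ?case
    by (simp add: sum_words_Suc pk_def p_sum flip: sum_distrib_left)
qed (simp add: pk_def)

lemma blockenc_nonneg: "us \<in> words S k \<Longrightarrow> 0 \<le> blockenc x0 n r f us xs"
  by (induction us arbitrary: k xs) (auto simp: words_def f_nonneg)

lemma length_Suc_eq: "n * Suc k + r = n + (n * k + r)" by simp

lemma blockenc_sum: "us \<in> words S k \<Longrightarrow> (\<Sum>xs\<in>seqs (n * k + r). blockenc x0 n r f us xs) = 1"
proof (induction k arbitrary: us)
  case 0
  moreover have "replicate r x0 \<in> seqs r" by (simp add: seqs_def)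
  ultimately show ?case by (simp add: sum.delta)
next
  case (Suc k)
  then obtain u us' where us: "us = u # us'" "u \<in> S" "us' \<in> words S k" by (auto simp: words_Suc_iff)
  have "(\<Sum>xs\<in>seqs (n * Suc k + r). blockenc x0 n r f us xs)
      = (\<Sum>a\<in>seqs n. \<Sum>b\<in>seqs (n * k + r). f u a * blockenc x0 n r f us' b)"
    unfolding length_Suc_eq sum_seqs_append us
    by (intro sum.cong refl) (simp add: length_seqs)
  then show ?case using Suc.IH us f_sum by (simp flip: sum_distrib_left)
qed

lemma vk_nonneg: "us \<in> words S k \<Longrightarrow> 0 \<le> vk k us b"
  unfolding vk_def using V blockenc_nonneg by (intro outch_nonneg)

lemma vk_sum: "us \<in> words S k \<Longrightarrow> (\<Sum>b\<in>seqs (n * k + r). vk k us b) = 1"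
  unfolding vk_def using V by (simp add: sum_outch blockenc_sum)

lemma v_nonneg: "u \<in> S \<Longrightarrow> 0 \<le> v u a"
  unfolding v_def using V f_nonneg by (intro outch_nonneg)

lemma v_sum: "u \<in> S \<Longrightarrow> (\<Sum>a\<in>seqs n. v u a) = 1"
  unfolding v_def using V by (simp add: sum_outch f_sum)

lemma vk_Cons:
  assumes "a \<in> seqs n"
  shows "vk (Suc k) (u # us) (a @ b) = v u a * vk k us b"
proof -
  have "vk (Suc k) (u # us) (a @ b) = (\<Sum>xs\<in>seqs n. \<Sum>xs'\<in>seqs (n * k + r).
      (f u xs * wn V xs a) * (blockenc x0 n r f us xs' * wn V xs' b))"
    unfolding vk_def length_Suc_eq outch_def sum_seqs_append using assms
    by (intro sum.cong refl) (simp add: length_seqs wn_append)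
  then show ?thesis by (simp add: v_def vk_def outch_def sum_product)
qed

lemma qk_Cons: "a \<in> seqs n \<Longrightarrow> qk (Suc k) (a @ b) = out S p v a * qk k b"
  by (simp add: qk_def out_def sum_words_Suc vk_Cons sum_product pk_def ac_simps)

lemma qk_pos: "us \<in> words S k \<Longrightarrow> 0 < vk k us b \<Longrightarrow> 0 < qk k b"
  unfolding qk_def using pk_pos vk_nonneg finS by (intro out_pos) auto

lemma E_Suc:
  "E (Suc k) G = (\<Sum>u\<in>S. \<Sum>a\<in>seqs n. p u * v u a * E k (\<lambda>us b. G (u # us) (a @ b)))"
proof -
  have "E (Suc k) G = (\<Sum>u\<in>S. \<Sum>us\<in>words S k. \<Sum>a\<in>seqs n. \<Sum>b\<in>seqs (n * k + r).
      p u * v u a * (pk us * vk k us b * G (u # us) (a @ b)))"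
    unfolding E_def sum_words_Suc length_Suc_eq sum_seqs_append
    by (intro sum.cong refl) (simp add: vk_Cons pk_def)
  also have "\<dots> = (\<Sum>u\<in>S. \<Sum>a\<in>seqs n. \<Sum>us\<in>words S k. \<Sum>b\<in>seqs (n * k + r).
      p u * v u a * (pk us * vk k us b * G (u # us) (a @ b)))"
    by (intro sum.cong refl sum.swap)
  finally show ?thesis by (simp add: E_def sum_distrib_left)
qed

lemma E_add: "E k (\<lambda>us b. G us b + H us b) = E k G + E k H"
  by (simp add: E_def distrib_left sum.distrib)

lemma E_cmult: "E k (\<lambda>us b. c * G us b) = c * E k G"
  by (simp add: E_def sum_distrib_left ac_simps)

lemma E_one: "E k (\<lambda>us b. 1) = 1"
  by (simp add: E_def vk_sum pk_sum flip: sum_distrib_left)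

lemma E_const: "E k (\<lambda>us b. c) = c"
  using E_cmult[of k c "\<lambda>_ _. 1"] E_one by simp

lemma E_mono:
  assumes "\<And>us b. us \<in> words S k \<Longrightarrow> 0 < vk k us b \<Longrightarrow> G us b \<le> H us b"
  shows "E k G \<le> E k H"
  unfolding E_def
proof (intro sum_mono)
  fix us and b :: "'y list" assume us: "us \<in> words S k"
  show "pk us * vk k us b * G us b \<le> pk us * vk k us b * H us b"
  proof (cases "vk k us b = 0")
    case False
    then have "0 < vk k us b" using vk_nonneg[OF us, of b] by simp
    then show ?thesis using assms[OF us] pk_pos[OF us] by (intro mult_left_mono) auto
  qed simp
qed

lemma E_cong:
  assumes "\<And>us b. us \<in> words S k \<Longrightarrow> 0 < vk k us b \<Longrightarrow> G us b = H us b"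
  shows "E k G = E k H"
  using assms by (intro antisym E_mono) auto

lemma out_v_pos: "u \<in> S \<Longrightarrow> 0 < v u a \<Longrightarrow> 0 < out S p v a"
  using finS p_pos v_nonneg by (intro out_pos) auto

lemma dk_Cons:
  assumes "u \<in> S" "a \<in> seqs n" "0 < v u a" "us \<in> words S k" "0 < vk k us b"
  shows "dk (Suc k) (u # us) (a @ b) = d1 u a + dk k us b"
  using assms out_v_pos[of u a] qk_pos[of us k b]
  by (simp add: dk_def d1_def vk_Cons qk_Cons ln_div ln_mult algebra_simps)

lemma mean_d1: "(\<Sum>u\<in>S. \<Sum>a\<in>seqs n. p u * v u a * d1 u a) = 0"
proof -
  have "(\<Sum>u\<in>S. \<Sum>a\<in>seqs n. p u * v u a) = 1"
    using v_sum p_sum by (simp flip: sum_distrib_left)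
  then show ?thesis
    by (simp add: d1_def right_diff_distrib sum_subtractf \<mu>_def minfo_def flip: sum_distrib_right)
qed

lemma dk_0: "us \<in> words S 0 \<Longrightarrow> 0 < vk 0 us b \<Longrightarrow> dk 0 us b = 0"
  by (simp add: dk_def qk_def out_def pk_def)

lemma E_Suc_cong:
  assumes "\<And>u a. u \<in> S \<Longrightarrow> a \<in> seqs n \<Longrightarrow> 0 < v u a \<Longrightarrow> E k (\<lambda>us b. G (u # us) (a @ b)) = H u a"
  shows "E (Suc k) G = (\<Sum>u\<in>S. \<Sum>a\<in>seqs n. p u * v u a * H u a)"
  unfolding E_Suc
proof (intro sum.cong refl)
  fix u and a :: "'y list" assume *: "u \<in> S" "a \<in> seqs n"
  show "p u * v u a * E k (\<lambda>us b. G (u # us) (a @ b)) = p u * v u a * H u a"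
    using assms[OF *] v_nonneg[OF *(1), of a] by (cases "v u a = 0") auto
qed

lemma first_moment: "E k (dk k) = 0"
proof (induction k)
  case 0
  have "E 0 (dk 0) = E 0 (\<lambda>us b. 0)" by (intro E_cong dk_0)
  then show ?case by (simp add: E_const)
next
  case (Suc k)
  have "E (Suc k) (dk (Suc k)) = (\<Sum>u\<in>S. \<Sum>a\<in>seqs n. p u * v u a * d1 u a)"
  proof (rule E_Suc_cong)
    fix u and a :: "'y list" assume *: "u \<in> S" "a \<in> seqs n" "0 < v u a"
    have "E k (\<lambda>us b. dk (Suc k) (u # us) (a @ b)) = E k (\<lambda>us b. d1 u a + dk k us b)"
      using * by (intro E_cong dk_Cons)
    then show "E k (\<lambda>us b. dk (Suc k) (u # us) (a @ b)) = d1 u a"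
      by (simp add: E_add E_const Suc)
  qed
  then show ?case by (simp add: mean_d1)
qed

text \<open>Variances of independent blocks add: the cross term carries the mean over the remaining
  blocks, which is 0 by \<open>first_moment\<close>.\<close>

lemma second_moment: "E k (\<lambda>us b. (dk k us b)\<^sup>2) = real k * \<sigma>2"
proof (induction k)
  case 0
  have "E 0 (\<lambda>us b. (dk 0 us b)\<^sup>2) = E 0 (\<lambda>us b. 0)" by (intro E_cong) (simp add: dk_0)
  then show ?case by (simp add: E_const)
next
  case (Suc k)
  have "E (Suc k) (\<lambda>us b. (dk (Suc k) us b)\<^sup>2)
    = (\<Sum>u\<in>S. \<Sum>a\<in>seqs n. p u * v u a * ((d1 u a)\<^sup>2 + real k * \<sigma>2))"
  proof (rule E_Suc_cong)
    fix u and a :: "'y list" assume *: "u \<in> S" "a \<in> seqs n" "0 < v u a"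
    have "E k (\<lambda>us b. (dk (Suc k) (u # us) (a @ b))\<^sup>2)
      = E k (\<lambda>us b. ((d1 u a)\<^sup>2 + 2 * d1 u a * dk k us b) + (dk k us b)\<^sup>2)"
      using * by (intro E_cong) (simp add: dk_Cons power2_sum)
    then show "E k (\<lambda>us b. (dk (Suc k) (u # us) (a @ b))\<^sup>2) = (d1 u a)\<^sup>2 + real k * \<sigma>2"
      by (simp add: E_add E_const E_cmult first_moment Suc)
  qed
  also have "\<dots> = \<sigma>2 + real k * \<sigma>2"
    using v_sum p_sum
    by (simp add: distrib_left sum.distrib \<sigma>2_def flip: sum_distrib_left sum_distrib_right)
  finally show ?case by (simp add: algebra_simps)
qed

lemma density_exp:
  assumes "us \<in> words S k" "0 < vk k us b"
  shows "vk k us b = qk k b * exp (real k * \<mu> + dk k us b)"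
  using assms qk_pos[OF assms] by (simp add: dk_def)

text \<open>Wrong indices have relative weight \<open>N * qk k b / (vk k us b + N * qk k b)\<close>.
  It is small unless the density falls \<open>k * \<delta>\<close> below its mean, and that event is
  charged to the squared deviation, as in Chebyshev's inequality. Adding both costs pointwise covers
  the two cases at once.\<close>

lemma error_bound:
  assumes "0 < \<delta>" "1 \<le> k" "0 < N"
  shows "1 - (\<Sum>us\<in>words S k. \<Sum>b\<in>seqs (n * k + r). pk us * ((vk k us b)\<^sup>2 / (vk k us b + N * qk k b)))
    \<le> N * exp (- (real k * \<mu>) + real k * \<delta>) + \<sigma>2 / (real k * \<delta>\<^sup>2)"
proof -
  define G where "G us b = vk k us b / (vk k us b + N * qk k b)" for us b
  define e where "e = N * exp (- (real k * \<mu>) + real k * \<delta>)"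
  define c where "c = 1 / (real k * \<delta>)\<^sup>2"
  have e0: "0 < e" using assms by (simp add: e_def)
  have "E k (\<lambda>us b. 1) \<le> E k (\<lambda>us b. G us b + e + c * (dk k us b)\<^sup>2)"
  proof (rule E_mono)
    fix us b assume us: "us \<in> words S k" "0 < vk k us b"
    have q: "0 < qk k b" using qk_pos us by blast
    have G1: "G us b = 1 - N * qk k b / (vk k us b + N * qk k b)"
    proof -
      have "0 < vk k us b + N * qk k b" using us q assms by (intro add_pos_pos) auto
      then show ?thesis by (simp add: G_def field_simps)
    qed
    show "1 \<le> G us b + e + c * (dk k us b)\<^sup>2"
    proof (cases "- (real k * \<delta>) \<le> dk k us b")
      case True
      have "N * qk k b / (vk k us b + N * qk k b) \<le> N * qk k b / vk k us b"
        using us q assms by (intro divide_left_mono) (auto intro!: mult_pos_pos add_pos_pos)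
      also have "\<dots> = N * exp (- (real k * \<mu> + dk k us b))"
        unfolding exp_minus using density_exp[OF us] q by (simp add: field_simps)
      also have "\<dots> \<le> e" unfolding e_def using True assms by (intro mult_left_mono) auto
      finally have "N * qk k b / (vk k us b + N * qk k b) \<le> e" .
      moreover have "0 \<le> c * (dk k us b)\<^sup>2" by (simp add: c_def)
      ultimately show ?thesis unfolding G1 by linarith
    next
      case False
      then have "(real k * \<delta>)\<^sup>2 \<le> (- dk k us b)\<^sup>2" using assms by (intro power_mono) auto
      then have "1 \<le> c * (dk k us b)\<^sup>2" using assms by (simp add: c_def field_simps)
      moreover have "0 \<le> G us b" using us q assms by (simp add: G_def)
      ultimately show ?thesis using e0 by linarith
    qed
  qed
  also have "\<dots> = E k G + e + c * (real k * \<sigma>2)"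
    by (simp add: E_add E_const E_cmult second_moment)
  also have "c * (real k * \<sigma>2) = \<sigma>2 / (real k * \<delta>\<^sup>2)"
    using assms by (simp add: c_def field_simps power2_eq_square)
  also have "E k G = (\<Sum>us\<in>words S k. \<Sum>b\<in>seqs (n * k + r). pk us * ((vk k us b)\<^sup>2 / (vk k us b + N * qk k b)))"
    by (simp add: E_def G_def power2_eq_square mult.assoc)
  finally show ?thesis by (simp add: E_one e_def)
qed

text \<open>With L at least \<open>exp (k * \<mu>)\<close> the integrand is at most
  \<open>ln 2 + \<bar>d\<bar>\<close> for the centred density d, and \<open>\<bar>d\<bar>\<close> is
  traded for its square at scale \<open>sqrt k\<close>. Order \<open>sqrt k\<close> disappears after
  division by the block length, so the number of columns carries no exponential margin.\<close>

lemma leakage_bound: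
  assumes "1 \<le> k" "exp (real k * \<mu>) \<le> L"
  shows "(\<Sum>us\<in>words S k. \<Sum>b\<in>seqs (n * k + r). pk us * (vk k us b * ln (1 + vk k us b / (L * qk k b))))
    \<le> ln 2 + (\<sigma>2 + 1) * sqrt (real k)"
proof -
  have k: "0 < sqrt (real k)" "sqrt (real k) * sqrt (real k) = real k" using assms by auto
  have L: "0 < L" using assms(2) exp_gt_zero[of "real k * \<mu>"] by linarith
  have "E k (\<lambda>us b. ln (1 + vk k us b / (L * qk k b)))
    \<le> E k (\<lambda>us b. (ln 2 + sqrt (real k)) + (1 / sqrt (real k)) * (dk k us b)\<^sup>2)"
  proof (rule E_mono)
    fix us b assume us: "us \<in> words S k" "0 < vk k us b"
    have q: "0 < qk k b" using qk_pos us by blast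
    define d where "d = dk k us b"
    have "vk k us b / (L * qk k b) = exp (real k * \<mu>) / L * exp d"
      using density_exp[OF us] q by (simp add: d_def exp_add)
    also have "\<dots> \<le> 1 * exp d" using assms L by (intro mult_right_mono) auto
    also have "\<dots> \<le> exp \<bar>d\<bar>" by simp
    finally have "1 + vk k us b / (L * qk k b) \<le> 2 * exp \<bar>d\<bar>"
      using one_le_exp_iff[of "\<bar>d\<bar>"] by linarith
    moreover have "0 < 1 + vk k us b / (L * qk k b)"
      using us q L by (simp add: add_pos_pos)
    ultimately have "ln (1 + vk k us b / (L * qk k b)) \<le> ln (2 * exp \<bar>d\<bar>)"
      by (subst ln_le_cancel_iff) auto
    also have "\<dots> = ln 2 + \<bar>d\<bar>" by (simp add: ln_mult)
    also have "\<bar>d\<bar> \<le> sqrt (real k) + (1 / sqrt (real k)) * d\<^sup>2"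
    proof (cases "\<bar>d\<bar> \<le> sqrt (real k)")
      case True
      moreover have "0 \<le> (1 / sqrt (real k)) * d\<^sup>2" by simp
      ultimately show ?thesis by linarith
    next
      case False
      then have "sqrt (real k) * \<bar>d\<bar> \<le> \<bar>d\<bar> * \<bar>d\<bar>" by (intro mult_right_mono) auto
      then have "\<bar>d\<bar> \<le> (1 / sqrt (real k)) * d\<^sup>2" using k
        by (simp add: field_simps power2_eq_square)
      then show ?thesis using k by linarith
    qed
    finally show "ln (1 + vk k us b / (L * qk k b))
      \<le> (ln 2 + sqrt (real k)) + (1 / sqrt (real k)) * (dk k us b)\<^sup>2"
      by (simp add: d_def)
  qed
  also have "\<dots> = (ln 2 + sqrt (real k)) + (1 / sqrt (real k)) * (real k * \<sigma>2)"
    by (simp only: E_add E_const E_cmult second_moment)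
  also have "\<dots> = ln 2 + (\<sigma>2 + 1) * sqrt (real k)"
    using k by (simp add: field_simps)
  finally show ?thesis by (simp add: E_def mult.assoc)
qed

end

section \<open>Achievability with vanishing error at every block length\<close>

lemma coding_error_tendsto_0:
  fixes \<delta> a b :: real
  assumes "0 < \<delta>"
  shows "(\<lambda>k. 2 * exp (- (real k * \<delta>)) + a / (real k * \<delta>\<^sup>2) + (ln 2 + (b + 1) * sqrt (real k)) / real k)
    \<longlonglongrightarrow> 0"
  using assms by real_asymp

text \<open>Over k blocks there are about \<open>exp (k * n * R)\<close> messages and
  \<open>exp (k * IB)\<close> columns. Their product stays exponentially below
  \<open>exp (k * IA)\<close>, which the receiver can resolve, while the columns alone saturate the
  eavesdropper. The weight \<open>1 / k\<close> on the leakage lets both quantities share one bound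
  tending to 0.\<close>

lemma achievability:
  fixes W :: "'x::finite \<Rightarrow> 'y::finite \<Rightarrow> 'z::finite \<Rightarrow> real"
  assumes W: "is_channel W" and n: "1 \<le> n" and S: "finite S"
    and p: "\<And>u. u \<in> S \<Longrightarrow> 0 < p u" "sum p S = 1"
    and f: "\<And>u xs. u \<in> S \<Longrightarrow> 0 \<le> f u xs" "\<And>u. u \<in> S \<Longrightarrow> (\<Sum>xs\<in>seqs n. f u xs) = 1"
    and R: "0 \<le> R" "real n * R < minfo S p (outch f (margY W) n) (seqs n) - minfo S p (outch f (margZ W) n) (seqs n)"
  shows "eps_achievable W 0 R"
proof -
  define x0 :: 'x where "x0 = undefined"
  have Y: "block_channel S p f (margY W) n" and Z: "block_channel S p f (margZ W) n"
    using S p f W by (unfold_locales; simp add: stochastic_margY stochastic_margZ)+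
  define IA where "IA = minfo S p (outch f (margY W) n) (seqs n)"
  define IB where "IB = minfo S p (outch f (margZ W) n) (seqs n)"
  define a where "a = block_channel.\<sigma>2 S p f (margY W) n"
  define b where "b = block_channel.\<sigma>2 S p f (margZ W) n"
  \<comment> \<open>Half the gap: one half absorbs the Chebyshev slack \<open>k * \<delta>\<close>,
    the other is the surviving decay \<open>exp (- k * \<delta>)\<close>.\<close>
  define \<delta> where "\<delta> = (IA - IB - real n * R) / 2"
  have \<delta>: "0 < \<delta>" using R by (simp add: \<delta>_def IA_def IB_def)
  have IB0: "0 \<le> IB"
  proof -
    have vB0: "0 \<le> outch f (margZ W) n u b" if "u \<in> S" for u b
      using W f that by (intro outch_nonneg stochastic_margZ)
    have "0 \<le> (\<Sum>b\<in>seqs n. outch f (margZ W) n u b * ln (outch f (margZ W) n u b / out S p (outch f (margZ W) n) b))"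
      if u: "u \<in> S" for u
    proof (rule gibbs)
      show "outch f (margZ W) n u b = 0" if "out S p (outch f (margZ W) n) b = 0" for b
        using out_pos[of S p "outch f (margZ W) n" b u] S p u that vB0
        by (metis less_irrefl order_less_le)
    qed (use W p f u in \<open>auto simp: sum_outch stochastic_margZ sum_out less_imp_le
       intro!: vB0 out_nonneg\<close>)
    then have "0 \<le> (\<Sum>u\<in>S. p u * (\<Sum>b\<in>seqs n. outch f (margZ W) n u b * ln (outch f (margZ W) n u b / out S p (outch f (margZ W) n) b)))"
      using p(1) by (meson less_imp_le mult_nonneg_nonneg sum_nonneg)
    then show ?thesis by (simp add: IB_def minfo_def sum_distrib_left mult.assoc)
  qed
  \<comment> \<open>Rounding costs at most a factor 2 in each number because both exponentials are
    at least 1; this is where \<open>0 \<le> R\<close> and \<open>IB0\<close> enter.\<close>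
  define M where "M k = nat \<lfloor>exp (real k * (real n * R))\<rfloor>" for k
  define L where "L k = nat \<lceil>exp (real k * IB)\<rceil>" for k
  define e where "e k = 2 * exp (- (real k * \<delta>)) + a / (real k * \<delta>\<^sup>2) + (ln 2 + (b + 1) * sqrt (real k)) / real k" for k
  have M1: "1 \<le> M k" for k
  proof -
    have "1 \<le> exp (real k * (real n * R))" using R by simp
    then show ?thesis by (simp add: M_def le_nat_iff le_floor_iff)
  qed
  have M_le: "real (M k) \<le> exp (real k * (real n * R))" for k
    by (simp add: M_def)
  have M_ge: "exp (real k * (real n * R)) \<le> 2 * real (M k)" for k
    using M1[of k] by (simp add: M_def) linarith
  have L_ge: "exp (real k * IB) \<le> real (L k)" for k
    by (simp add: L_def)
  have L_le: "real (L k) \<le> 2 * exp (real k * IB)" for k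
  proof -
    have "1 \<le> exp (real k * IB)" using IB0 by simp
    then show ?thesis unfolding L_def by linarith
  qed
  have L1: "1 \<le> L k" for k
    using L_ge[of k] exp_gt_zero[of "real k * IB"] by linarith
  have "\<exists>phi psi. is_code (n * k + r) (M k) phi psi \<and>
      (1 \<le> k \<longrightarrow> prob_error W (n * k + r) (M k) phi psi + (1 / real k) * mutual_info_MZ W (n * k + r) (M k) phi \<le> e k)"
    for k r
  proof -
    interpret Y: block_channel S p f "margY W" n r x0 by (rule Y)
    interpret Z: block_channel S p f "margZ W" n r x0 by (rule Z)
    have *: "\<exists>phi psi. is_code (n * k + r) (M k) phi psi \<and>
        prob_error W (n * k + r) (M k) phi psi + \<kappa> * mutual_info_MZ W (n * k + r) (M k) phi
        \<le> 1 - (\<Sum>us\<in>words S k. \<Sum>a\<in>seqs (n * k + r). Y.pk us * ((Y.vk k us a)\<^sup>2 / (Y.vk k us a + real (M k * L k) * Y.qk k a)))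
      + \<kappa> * (\<Sum>us\<in>words S k. \<Sum>b\<in>seqs (n * k + r). Z.pk us * (Z.vk k us b * ln (1 + Z.vk k us b / (real (L k) * Z.qk k b))))"
      if "0 \<le> \<kappa>" for \<kappa>
      unfolding Y.vk_def Z.vk_def Y.qk_def Z.qk_def
      using W S that M1 L1
      by (intro wiretap_one_shot) (auto simp: Y.pk_pos Y.pk_sum intro: Y.blockenc_nonneg Y.blockenc_sum)
    show ?thesis
    proof (cases "1 \<le> k")
      case False
      \<comment> \<open>For \<open>k = 0\<close> the word is all padding and only a code is
        demanded, so weight 0 serves.\<close>
      then show ?thesis using *[of 0] by auto
    next
      case True
      have "real (M k * L k) * exp (- (real k * IA) + real k * \<delta>)
        \<le> (exp (real k * (real n * R)) * (2 * exp (real k * IB))) * exp (- (real k * IA) + real k * \<delta>)"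
        unfolding of_nat_mult using M_le L_le by (intro mult_right_mono mult_mono) auto
      also have "\<dots> = 2 * exp (real k * (real n * R) + real k * IB + (- (real k * IA) + real k * \<delta>))"
        by (simp add: exp_add)
      also have "real k * (real n * R) + real k * IB + (- (real k * IA) + real k * \<delta>) = - (real k * \<delta>)"
        by (simp add: \<delta>_def field_simps)
      finally have "1 - (\<Sum>us\<in>words S k. \<Sum>a\<in>seqs (n * k + r). Y.pk us * ((Y.vk k us a)\<^sup>2 / (Y.vk k us a + real (M k * L k) * Y.qk k a)))
        \<le> 2 * exp (- (real k * \<delta>)) + a / (real k * \<delta>\<^sup>2)"
        using Y.error_bound[OF \<delta> True, of "real (M k * L k)"] M1[of k] L1[of k]
        by (simp add: a_def IA_def Y.\<mu>_def Y.v_def)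
      moreover have "(1 / real k) * (\<Sum>us\<in>words S k. \<Sum>b\<in>seqs (n * k + r). Z.pk us * (Z.vk k us b * ln (1 + Z.vk k us b / (real (L k) * Z.qk k b))))
        \<le> (1 / real k) * (ln 2 + (b + 1) * sqrt (real k))"
        unfolding b_def using L_ge[of k]
        by (intro mult_left_mono Z.leakage_bound True) (auto simp: IB_def Z.\<mu>_def Z.v_def)
      ultimately show ?thesis using *[of "1 / real k"] by (fastforce simp: e_def)
    qed
  qed
  then obtain phi psi where code: "\<And>k r. is_code (n * k + r) (M k) (phi k r) (psi k r)"
    and bound: "\<And>k r. 1 \<le> k \<Longrightarrow> prob_error W (n * k + r) (M k) (phi k r) (psi k r)
       + (1 / real k) * mutual_info_MZ W (n * k + r) (M k) (phi k r) \<le> e k"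
    by metis
  define K where "K N = M (N div n)" for N
  define Phi where "Phi N = phi (N div n) (N mod n)" for N
  define Psi where "Psi N = psi (N div n) (N mod n)" for N
  have codeN: "is_code N (K N) (Phi N) (Psi N)" for N
    using code[of "N div n" "N mod n"] by (simp add: K_def Phi_def Psi_def)
  have err0: "0 \<le> prob_error W N (K N) (Phi N) (Psi N)" for N
    using prob_correct_le_1[OF W codeN] by (simp add: prob_error_def)
  have mi0: "0 \<le> mutual_info_MZ W N (K N) (Phi N)" for N
    using mutual_info_MZ_nonneg[OF W codeN] .
  have boundN: "prob_error W N (K N) (Phi N) (Psi N)
       + (1 / real (N div n)) * mutual_info_MZ W N (K N) (Phi N) \<le> e (N div n)" if "n \<le> N" for N
    using bound[of "N div n" "N mod n"] n that by (simp add: K_def Phi_def Psi_def div_greater_zero_iff Suc_le_eq)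
  have lim_div: "filterlim (\<lambda>N. N div n) at_top at_top"
    using n by (intro filterlim_at_top_div_const_nat) auto
  have e0: "(\<lambda>N. e (N div n)) \<longlonglongrightarrow> 0"
    using filterlim_compose[OF coding_error_tendsto_0[OF \<delta>, of a b] lim_div] by (simp add: e_def)
  have "(\<lambda>N. prob_error W N (K N) (Phi N) (Psi N)) \<longlonglongrightarrow> 0"
  proof (rule tendsto_sandwich[OF _ _ tendsto_const e0])
    show "\<forall>\<^sub>F N in sequentially. prob_error W N (K N) (Phi N) (Psi N) \<le> e (N div n)"
      using eventually_ge_at_top[of n]
    proof eventually_elim
      case (elim N)
      have "0 \<le> (1 / real (N div n)) * mutual_info_MZ W N (K N) (Phi N)" using mi0 by simp
      then show ?case using boundN[OF elim] by linarith
    qed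
  qed (use err0 in auto)
  then have "limsup (\<lambda>N. ereal (prob_error W N (K N) (Phi N) (Psi N))) = ereal 0"
    by (intro lim_imp_Limsup tendsto_ereal) auto
  moreover have "(\<lambda>N. mutual_info_MZ W N (K N) (Phi N) / real N) \<longlonglongrightarrow> 0"
  proof (rule tendsto_sandwich[OF _ _ tendsto_const e0])
    show "\<forall>\<^sub>F N in sequentially. mutual_info_MZ W N (K N) (Phi N) / real N \<le> e (N div n)"
      using eventually_ge_at_top[of n]
    proof eventually_elim
      case (elim N)
      have "0 < N div n" using elim n by (simp add: div_greater_zero_iff)
      then have "mutual_info_MZ W N (K N) (Phi N) / real N \<le> mutual_info_MZ W N (K N) (Phi N) / real (N div n)"
        using mi0 elim n by (intro divide_left_mono) auto
      then show ?case using boundN[OF elim] err0[of N] by simp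
    qed
  qed (use mi0 in auto)
  moreover have "ereal R \<le> liminf (\<lambda>N. ereal (ln (real (K N)) / real N))"
  proof -
    have "(\<lambda>N. ereal (R - (real n * R + ln 2) / real N)) \<longlonglongrightarrow> ereal R"
      by (intro tendsto_ereal) real_asymp
    then have "ereal R = liminf (\<lambda>N. ereal (R - (real n * R + ln 2) / real N))"
      by (intro lim_imp_Liminf[symmetric]) auto
    also have "\<dots> \<le> liminf (\<lambda>N. ereal (ln (real (K N)) / real N))"
    proof (rule Liminf_mono)
      show "\<forall>\<^sub>F N in sequentially. ereal (R - (real n * R + ln 2) / real N) \<le> ereal (ln (real (K N)) / real N)"
        using eventually_ge_at_top[of 1]
      proof eventually_elim
        case (elim N)
        define k where "k = N div n"
        \<comment> \<open>Padding wastes fewer than n letters, a rate loss of at most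
          \<open>n * R / N\<close>; the \<open>ln 2\<close> is the rounding of
          \<open>M k\<close>.\<close>
        have "N < n * k + n" unfolding k_def using n by (metis add.commute dividend_less_times_div less_le_trans zero_less_one)
        then have "real N \<le> real n * real k + real n" by (metis less_imp_le of_nat_add of_nat_le_iff of_nat_mult)
        then have "real N * R \<le> (real n * real k + real n) * R" using R by (intro mult_right_mono) auto
        moreover have "real k * (real n * R) \<le> ln 2 + ln (real (M k))"
        proof -
          have "ln (exp (real k * (real n * R))) \<le> ln (2 * real (M k))"
            using M_ge[of k] M1[of k] by (subst ln_le_cancel_iff) auto
          then show ?thesis using M1[of k] by (simp add: ln_mult)
        qed
        ultimately have "R * real N - (real n * R + ln 2) \<le> ln (real (M k))"
          by (simp add: algebra_simps)
        then have "(R * real N - (real n * R + ln 2)) / real N \<le> ln (real (M k)) / real N"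
          by (intro divide_right_mono) auto
        then have "R - (real n * R + ln 2) / real N \<le> ln (real (M k)) / real N"
          using elim by (simp add: diff_divide_distrib)
        then show ?case by (simp add: K_def k_def)
      qed
    qed
    finally show ?thesis .
  qed
  ultimately show ?thesis
    unfolding eps_achievable_def using codeN by (intro exI[of _ K] exI[of _ Phi] exI[of _ Psi]) auto
qed

section \<open>Distance to a decoding set\<close>

text \<open>Letters beyond the end of the shorter word are not counted, hence the equal lengths in
  the triangle inequality.\<close>

fun ham :: "'a list \<Rightarrow> 'a list \<Rightarrow> nat" where
  "ham (x # xs) (y # ys) = (if x = y then 0 else 1) + ham xs ys"
| "ham _ _ = 0"

lemma ham_refl [simp]: "ham xs xs = 0"
  by (induction xs) auto

lemma ham_triangle:
  "length a = length b \<Longrightarrow> length b = length c \<Longrightarrow> ham a c \<le> ham a b + ham b c"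
  by (induction a b c rule: list_induct3) auto

lemma ham_sym: "ham a b = ham b a"
  by (induction a b rule: ham.induct) auto

lemma wn_average_le:
  fixes V :: "'x \<Rightarrow> 'y::finite \<Rightarrow> real"
  assumes "stochastic V" "\<And>y. g y \<le> c"
  shows "(\<Sum>y\<in>UNIV. V x y * g y) \<le> c"
proof -
  have "(\<Sum>y\<in>UNIV. V x y * g y) \<le> (\<Sum>y\<in>UNIV. V x y * c)"
    using assms by (intro sum_mono mult_left_mono) (auto simp: stochastic_nonneg)
  then show ?thesis using assms by (simp add: stochastic_sum flip: sum_distrib_right)
qed

text \<open>Efron--Stein: each coordinate contributes at most one to the variance.\<close>

lemma lipschitz_variance:
  fixes V :: "'x \<Rightarrow> 'y::finite \<Rightarrow> real" and f :: "'y list \<Rightarrow> real"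
  assumes "stochastic V" "length xs = n"
    and "\<And>a b. a \<in> seqs n \<Longrightarrow> b \<in> seqs n \<Longrightarrow> \<bar>f a - f b\<bar> \<le> real (ham a b)"
  shows "(\<Sum>ys\<in>seqs n. wn V xs ys * (f ys - (\<Sum>ys'\<in>seqs n. wn V xs ys' * f ys'))\<^sup>2) \<le> real n"
  using assms(2,3)
proof (induction n arbitrary: xs f)
  case 0
  then show ?case by simp
next
  case (Suc n)
  then obtain x xs' where xs: "xs = x # xs'" "length xs' = n" by (auto simp: length_Suc_conv)
  \<comment> \<open>Conditional mean given the first letter. The law of total variance splits the
    variance into that of the tail, bounded by induction, and that of g, which is at most 1 because
    changing one letter moves f by at most 1.\<close>
  define g where "g y = (\<Sum>ys\<in>seqs n. wn V xs' ys * f (y # ys))" for y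
  define \<mu> where "\<mu> = (\<Sum>ys\<in>seqs (Suc n). wn V xs ys * f ys)"
  have \<mu>: "\<mu> = (\<Sum>y\<in>UNIV. V x y * g y)"
    by (simp add: \<mu>_def g_def xs sum_seqs_Suc sum_distrib_left mult.assoc)
  have S1: "(\<Sum>ys\<in>seqs n. wn V xs' ys) = 1" using assms(1) xs by (simp add: sum_wn)
  have gdiff: "g y - g y' \<le> 1" for y y'
  proof -
    have "g y - g y' = (\<Sum>ys\<in>seqs n. wn V xs' ys * (f (y # ys) - f (y' # ys)))"
      by (simp add: g_def right_diff_distrib sum_subtractf)
    also have "\<dots> \<le> (\<Sum>ys\<in>seqs n. wn V xs' ys * 1)"
    proof (intro sum_mono mult_left_mono)
      fix ys :: "'y list" assume "ys \<in> seqs n"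
      then have "\<bar>f (y # ys) - f (y' # ys)\<bar> \<le> real (ham (y # ys) (y' # ys))"
        by (intro Suc.prems) (auto simp: seqs_def)
      also have "\<dots> \<le> 1" by simp
      finally show "f (y # ys) - f (y' # ys) \<le> 1" by simp
    qed (use assms(1) in \<open>simp add: wn_nonneg\<close>)
    finally show ?thesis by (simp add: S1)
  qed
  have "\<bar>g y - \<mu>\<bar> \<le> 1" for y
  proof -
    have "(\<Sum>y'\<in>UNIV. V x y' * (g y - g y')) \<le> 1" "(\<Sum>y'\<in>UNIV. V x y' * (g y' - g y)) \<le> 1"
      using gdiff assms(1) by (auto intro: wn_average_le)
    moreover have "(\<Sum>y'\<in>UNIV. V x y' * (g y - g y')) = g y - \<mu>"
      "(\<Sum>y'\<in>UNIV. V x y' * (g y' - g y)) = \<mu> - g y"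
      using assms(1) by (simp_all add: right_diff_distrib sum_subtractf \<mu> stochastic_sum flip: sum_distrib_right)
    ultimately show ?thesis by linarith
  qed
  then have g1: "(g y - \<mu>)\<^sup>2 \<le> 1" for y by (simp add: abs_square_le_1)
  have inner: "(\<Sum>ys\<in>seqs n. wn V xs' ys * (f (y # ys) - \<mu>)\<^sup>2) \<le> real n + 1" for y
  proof -
    have "(\<Sum>ys\<in>seqs n. wn V xs' ys * (f (y # ys) - \<mu>)\<^sup>2)
      = (\<Sum>ys\<in>seqs n. wn V xs' ys * (f (y # ys) - g y)\<^sup>2
          + (2 * (g y - \<mu>)) * (wn V xs' ys * f (y # ys) - wn V xs' ys * g y) + wn V xs' ys * (g y - \<mu>)\<^sup>2)"
      by (intro sum.cong refl) (simp add: power2_eq_square algebra_simps)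
    also have "\<dots> = (\<Sum>ys\<in>seqs n. wn V xs' ys * (f (y # ys) - g y)\<^sup>2) + (g y - \<mu>)\<^sup>2"
      using S1 by (simp add: sum.distrib sum_subtractf g_def[symmetric] flip: sum_distrib_left sum_distrib_right)
    also have "(\<Sum>ys\<in>seqs n. wn V xs' ys * (f (y # ys) - g y)\<^sup>2) \<le> real n"
      unfolding g_def
    proof (rule Suc.IH)
      fix a b :: "'y list" assume "a \<in> seqs n" "b \<in> seqs n"
      then show "\<bar>f (y # a) - f (y # b)\<bar> \<le> real (ham a b)"
        using Suc.prems(2)[of "y # a" "y # b"] by (simp add: seqs_def)
    qed (use xs in simp)
    finally show ?thesis using g1[of y] by linarith
  qed
  have "(\<Sum>ys\<in>seqs (Suc n). wn V xs ys * (f ys - \<mu>)\<^sup>2)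
     = (\<Sum>y\<in>UNIV. V x y * (\<Sum>ys\<in>seqs n. wn V xs' ys * (f (y # ys) - \<mu>)\<^sup>2))"
    by (simp add: xs sum_seqs_Suc sum_distrib_left mult.assoc)
  also have "\<dots> \<le> real n + 1"
    using assms(1) inner by (intro wn_average_le)
  finally show ?case by (simp add: \<mu>_def)
qed

text \<open>\<open>Min\<close> of the empty set is unspecified, so the facts below keep D finite and
  nonempty.\<close>

definition setdist :: "'a list set \<Rightarrow> 'a list \<Rightarrow> nat" where
  "setdist D ys = Min (ham ys ` D)"

lemma setdist_attained: "finite D \<Longrightarrow> D \<noteq> {} \<Longrightarrow> \<exists>b\<in>D. setdist D ys = ham ys b"
  unfolding setdist_def using Min_in[of "ham ys ` D"] by (simp add: image_iff)

lemma setdist_le: "finite D \<Longrightarrow> b \<in> D \<Longrightarrow> setdist D ys \<le> ham ys b"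
  unfolding setdist_def by auto

lemma setdist_lipschitz:
  assumes "finite D" "D \<noteq> {}" "D \<subseteq> seqs n" "a \<in> seqs n" "b \<in> seqs n"
  shows "setdist D a \<le> ham a b + setdist D b"
proof -
  obtain c where c: "c \<in> D" "setdist D b = ham b c" using setdist_attained assms by blast
  have "setdist D a \<le> ham a c" using c assms by (intro setdist_le)
  also have "\<dots> \<le> ham a b + ham b c"
    using c assms by (intro ham_triangle) (auto simp: seqs_def)
  finally show ?thesis using c by simp
qed

text \<open>The expected distance deviates from its value \<open>0\<close> on \<open>D\<close>, so Chebyshev bounds it.\<close>

lemma expected_setdist:
  fixes V :: "'x \<Rightarrow> 'y::finite \<Rightarrow> real"
  assumes V: "stochastic V" and xs: "length xs = n" and D: "D \<subseteq> seqs n"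
    and \<eta>: "0 < \<eta>" "\<eta> \<le> (\<Sum>ys\<in>D. wn V xs ys)"
  shows "(\<Sum>ys\<in>seqs n. wn V xs ys * real (setdist D ys)) \<le> sqrt (real n / \<eta>)"
proof -
  have D0: "D \<noteq> {}" using \<eta> by auto
  have fD: "finite D" using D by (rule finite_subset) simp
  define \<mu> where "\<mu> = (\<Sum>ys\<in>seqs n. wn V xs ys * real (setdist D ys))"
  have "setdist D ys = 0" if "ys \<in> D" for ys
    using setdist_le[OF fD that, of ys] by simp
  then have "(\<Sum>ys\<in>D. wn V xs ys) * \<mu>\<^sup>2 = (\<Sum>ys\<in>D. wn V xs ys * (real (setdist D ys) - \<mu>)\<^sup>2)"
    by (simp add: sum_distrib_right)
  also have "\<dots> \<le> (\<Sum>ys\<in>seqs n. wn V xs ys * (real (setdist D ys) - \<mu>)\<^sup>2)"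
    using D V by (intro sum_mono2) (auto simp: wn_nonneg)
  also have "\<dots> \<le> real n"
    unfolding \<mu>_def
  proof (rule lipschitz_variance[OF V xs])
    fix a b :: "'y list" assume "a \<in> seqs n" "b \<in> seqs n"
    then show "\<bar>real (setdist D a) - real (setdist D b)\<bar> \<le> real (ham a b)"
      using setdist_lipschitz[OF fD D0 D, of a b] setdist_lipschitz[OF fD D0 D, of b a]
      by (simp add: ham_sym[of b a])
  qed
  finally have "(\<Sum>ys\<in>D. wn V xs ys) * \<mu>\<^sup>2 \<le> real n" .
  then have "\<eta> * \<mu>\<^sup>2 \<le> real n"
    using \<eta> by (meson mult_right_mono order_trans zero_le_power2)
  then have "\<mu>\<^sup>2 \<le> real n / \<eta>" using \<eta> by (simp add: field_simps)
  then show ?thesis unfolding \<mu>_def by (rule real_le_rsqrt)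
qed

section \<open>Conditioning on a likely event\<close>

definition noise :: "real \<Rightarrow> 'y::finite \<Rightarrow> 'y \<Rightarrow> real" where
  "noise s y y' = (1 - s) * (if y = y' then 1 else 0) + s / real CARD('y)"

lemma stochastic_noise: "0 < s \<Longrightarrow> s < 1 \<Longrightarrow> stochastic (noise s :: 'y::finite \<Rightarrow> 'y \<Rightarrow> real)"
  by (auto simp: stochastic_def noise_def sum.distrib sum.delta simp flip: sum_distrib_left)

text \<open>For a changed letter \<open>s / CARD('y)\<close> alone is a lower bound. Keeping the
  factor \<open>1 - s\<close> in both cases turns the product over n letters into
  \<open>(1 - s) ^ n\<close> times a power whose exponent is the Hamming distance.\<close>

lemma noise_ge:
  fixes y y' :: "'y::finite"
  assumes "0 < s" "s < 1"
  shows "(1 - s) * (s / real CARD('y)) ^ (if y = y' then 0 else 1) \<le> noise s y y'"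
proof -
  have "(1 - s) * (s / real CARD('y)) \<le> 1 * (s / real CARD('y))"
    using assms by (intro mult_right_mono) auto
  then show ?thesis using assms by (auto simp: noise_def)
qed

lemma wn_noise_ge:
  fixes ys :: "'y::finite list"
  assumes s: "0 < s" "s < 1" and "length ys = n" "length ys' = n"
  shows "(1 - s) ^ n * (s / real CARD('y)) ^ ham ys ys' \<le> wn (noise s) ys ys'"
  using assms(3,4)
proof (induction n arbitrary: ys ys')
  case (Suc n)
  then obtain y zs y' zs' where *: "ys = y # zs" "ys' = y' # zs'" "length zs = n" "length zs' = n"
    by (auto simp: length_Suc_conv)
  have "((1 - s) * (s / real CARD('y)) ^ (if y = y' then 0 else 1)) * ((1 - s) ^ n * (s / real CARD('y)) ^ ham zs zs')
    \<le> noise s y y' * wn (noise s) zs zs'"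
    using * s Suc.IH
    by (intro mult_mono noise_ge stochastic_nonneg[OF stochastic_noise]) (auto intro!: mult_nonneg_nonneg)
  then show ?case by (simp add: * power_add ac_simps)
qed simp

text \<open>The probability of decoding \<open>m\<close> after replacing each output letter by a uniform one with
  probability \<open>s\<close>; it is positive everywhere and decays only with the distance to the decoding set.\<close>

definition listprob :: "real \<Rightarrow> nat \<Rightarrow> ('y::finite list \<Rightarrow> nat) \<Rightarrow> nat \<Rightarrow> 'y list \<Rightarrow> real" where
  "listprob s n psi m ys = (\<Sum>ys'\<in>{ys'\<in>seqs n. psi ys' = m}. wn (noise s) ys ys')"

lemma sum_listprob:
  assumes "0 < s" "s < 1" "ys \<in> seqs n" "finite S"
  shows "(\<Sum>m\<in>S. listprob s n psi m ys) \<le> 1"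
proof -
  have "(\<Sum>m\<in>S. listprob s n psi m ys) = (\<Sum>ys'\<in>(\<Union>m\<in>S. {ys'\<in>seqs n. psi ys' = m}). wn (noise s) ys ys')"
    unfolding listprob_def using assms(4) by (intro sum.UNION_disjoint[symmetric]) auto
  also have "\<dots> \<le> (\<Sum>ys'\<in>seqs n. wn (noise s) ys ys')"
    using assms by (intro sum_mono2) (auto intro: wn_nonneg stochastic_noise)
  also have "\<dots> = 1" using assms by (intro sum_wn stochastic_noise) (auto simp: seqs_def)
  finally show ?thesis .
qed

text \<open>Among all words decoded to m only the nearest one is kept, and
  \<open>wn_noise_ge\<close> is applied to it.\<close>

lemma listprob_ge:
  fixes ys :: "'y::finite list"
  assumes s: "0 < s" "s < 1" and ys: "ys \<in> seqs n" and D: "D = {ys'\<in>seqs n. psi ys' = m}" "D \<noteq> {}"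
  shows "0 < listprob s n psi m ys"
    and "real n * ln (1 - s) - real (setdist D ys) * ln (real CARD('y) / s) \<le> ln (listprob s n psi m ys)"
proof -
  have fD: "finite D" using D by simp
  obtain b where b: "b \<in> D" "setdist D ys = ham ys b" using setdist_attained[OF fD D(2)] by blast
  define t where "t = (1 - s) ^ n * (s / real CARD('y)) ^ setdist D ys"
  have "t \<le> wn (noise s) ys b"
    unfolding t_def b(2) using s ys b D by (intro wn_noise_ge) (auto simp: seqs_def)
  also have "\<dots> \<le> listprob s n psi m ys"
    unfolding listprob_def D(1)[symmetric] using s fD b
    by (intro member_le_sum) (auto intro: wn_nonneg stochastic_noise)
  finally have le: "t \<le> listprob s n psi m ys" .
  have t: "0 < t" using s by (simp add: t_def)
  then show "0 < listprob s n psi m ys" using le by linarith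
  have "ln t = real n * ln (1 - s) - real (setdist D ys) * ln (real CARD('y) / s)"
    using s by (simp add: t_def ln_mult ln_realpow ln_div algebra_simps)
  then show "real n * ln (1 - s) - real (setdist D ys) * ln (real CARD('y) / s) \<le> ln (listprob s n psi m ys)"
    using le t by (metis ln_le_cancel_iff order_less_le_trans)
qed

section \<open>Information bounds for the conditioned code\<close>

text \<open>Mutual information is the entropy of m minus its conditional entropy given a. The
  entropy is at least c because no probability exceeds \<open>exp (- c)\<close>. The conditional
  entropy is at most the expected \<open>- ln (Q m a)\<close> for any guessing law Q, since the
  divergence of \<open>p m * v m a\<close> from \<open>q a * Q m a\<close> is nonnegative.\<close>

lemma minfo_ge:
  assumes S: "finite S" "finite A" and p: "\<And>m. m \<in> S \<Longrightarrow> 0 < p m" "sum p S = 1"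
    and v: "\<And>m a. m \<in> S \<Longrightarrow> 0 \<le> v m a" "\<And>m. m \<in> S \<Longrightarrow> (\<Sum>a\<in>A. v m a) = 1"
    and c: "\<And>m. m \<in> S \<Longrightarrow> p m \<le> exp (- c)"
    and Q: "\<And>m a. m \<in> S \<Longrightarrow> a \<in> A \<Longrightarrow> 0 < Q m a" "\<And>a. a \<in> A \<Longrightarrow> (\<Sum>m\<in>S. Q m a) \<le> 1"
  shows "c + (\<Sum>m\<in>S. \<Sum>a\<in>A. p m * v m a * ln (Q m a)) \<le> minfo S p v A"
proof -
  define q where "q = out S p v"
  have q0: "0 \<le> q a" for a
    unfolding q_def using p v by (intro out_nonneg) (auto simp: less_imp_le)
  have qpos: "0 < q a" if "m \<in> S" "0 < v m a" for m a
    unfolding q_def using S p v that by (intro out_pos) auto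
  have total: "(\<Sum>m\<in>S. \<Sum>a\<in>A. p m * v m a) = 1"
    using v p by (simp flip: sum_distrib_left)
  have "0 \<le> (\<Sum>x\<in>S \<times> A. (case x of (m, a) \<Rightarrow> p m * v m a) *
     ln ((case x of (m, a) \<Rightarrow> p m * v m a) / (case x of (m, a) \<Rightarrow> q a * Q m a)))"
  proof (rule gibbs)
    have "(\<Sum>m\<in>S. \<Sum>a\<in>A. q a * Q m a) = (\<Sum>a\<in>A. q a * (\<Sum>m\<in>S. Q m a))"
      by (subst sum.swap) (simp add: sum_distrib_left)
    also have "\<dots> \<le> (\<Sum>a\<in>A. q a * 1)" using Q q0 by (intro sum_mono mult_left_mono) auto
    also have "\<dots> = 1" unfolding q_def using p v by (simp add: sum_out)
    finally show "(\<Sum>x\<in>S \<times> A. case x of (m, a) \<Rightarrow> q a * Q m a) \<le> (\<Sum>x\<in>S \<times> A. case x of (m, a) \<Rightarrow> p m * v m a)"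
      using total by (simp flip: sum.cartesian_product)
    show "(case x of (m, a) \<Rightarrow> p m * v m a) = 0"
      if x: "x \<in> S \<times> A" "(case x of (m, a) \<Rightarrow> q a * Q m a) = 0" for x
    proof -
      obtain m a where ma: "x = (m, a)" "m \<in> S" "a \<in> A" using x by auto
      then have "q a = 0" using x Q(1)[of m a] by auto
      then have "v m a = 0" using qpos[of m a] v(1)[of m a] ma by (auto simp: less_le)
      then show ?thesis by (simp add: ma)
    qed
  qed (use p v q0 Q in \<open>auto simp: less_imp_le\<close>)
  also have "\<dots> = (\<Sum>m\<in>S. \<Sum>a\<in>A. p m * v m a * ln (p m * v m a / (q a * Q m a)))"
    by (simp add: sum.cartesian_product case_prod_unfold)
  also have "\<dots> \<le> (\<Sum>m\<in>S. \<Sum>a\<in>A. p m * v m a * ln (v m a / q a) - p m * v m a * c - p m * v m a * ln (Q m a))"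
  proof (intro sum_mono)
    fix m a assume ma: "m \<in> S" "a \<in> A"
    show "p m * v m a * ln (p m * v m a / (q a * Q m a))
      \<le> p m * v m a * ln (v m a / q a) - p m * v m a * c - p m * v m a * ln (Q m a)"
    proof (cases "v m a = 0")
      case False
      then have vp: "0 < v m a" using v(1)[of m a] ma by simp
      have "ln (p m) \<le> ln (exp (- c))" using c[OF ma(1)] p(1)[OF ma(1)] by (subst ln_le_cancel_iff) auto
      then have "ln (p m * v m a / (q a * Q m a)) \<le> ln (v m a / q a) - c - ln (Q m a)"
        using vp qpos[OF ma(1) vp] p(1)[OF ma(1)] Q(1)[OF ma] by (simp add: ln_div ln_mult)
      then have "p m * v m a * ln (p m * v m a / (q a * Q m a)) \<le> p m * v m a * (ln (v m a / q a) - c - ln (Q m a))"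
        using vp p(1)[OF ma(1)] by (intro mult_left_mono) auto
      then show ?thesis by (simp add: algebra_simps)
    qed simp
  qed
  also have "\<dots> = minfo S p v A - c - (\<Sum>m\<in>S. \<Sum>a\<in>A. p m * v m a * ln (Q m a))"
    using total by (simp add: minfo_def q_def sum_subtractf flip: sum_distrib_right)
  finally show ?thesis by simp
qed

text \<open>Domination \<open>p m * v m b \<le> p_MZ / \<eta>\<close> is all that conditioning on a likely event leaves of the code.\<close>

lemma minfo_le_mutual_info:
  fixes W :: "'x::finite \<Rightarrow> 'y::finite \<Rightarrow> 'z::finite \<Rightarrow> real"
  assumes W: "is_channel W" and code: "is_code n K phi psi"
    and S: "S \<subseteq> {..<K}" and p: "\<And>m. m \<in> S \<Longrightarrow> 0 < p m" "sum p S = 1"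
    and v: "\<And>m b. m \<in> S \<Longrightarrow> 0 \<le> v m b" "\<And>m. m \<in> S \<Longrightarrow> (\<Sum>b\<in>seqs n. v m b) = 1"
    and \<eta>: "0 < \<eta>"
    and dom: "\<And>m b. m \<in> S \<Longrightarrow> b \<in> seqs n \<Longrightarrow> p m * v m b \<le> p_MZ W n K phi m b / \<eta>"
  shows "minfo S p v (seqs n) \<le> - ln \<eta> + (mutual_info_MZ W n K phi + 1) / \<eta>"
proof -
  define P0 where "P0 = p_MZ W n K phi"
  define r where "r = p_Z W n K phi"
  define q where "q = out S p v"
  have K: "0 < real K" using code by (simp add: is_code_def)
  have fS: "finite S" using S by (rule finite_subset) simp
  have q0: "0 \<le> q b" for b
    unfolding q_def using p v by (intro out_nonneg) (auto simp: less_imp_le)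
  have qpos: "0 < q b" if "m \<in> S" "0 < v m b" for m b
    unfolding q_def using fS p v that by (intro out_pos) auto
  have P0: "0 \<le> P0 m b" "P0 m b \<le> r b" "0 \<le> r b" if "m < K" "b \<in> seqs n" for m b
    using that p_MZ_nonneg[OF W code] p_MZ_le_p_Z[OF W code] p_Z_nonneg[OF W code]
    unfolding P0_def r_def by auto
  have P0pos: "0 < P0 m b" if mb: "m \<in> S" "b \<in> seqs n" "0 < v m b" for m b
  proof -
    have "0 < p m * v m b" using mb p by simp
    also have "\<dots> \<le> P0 m b / \<eta>" using dom mb by (simp add: P0_def)
    finally show ?thesis using \<eta> by (simp add: zero_less_divide_iff)
  qed
  have total: "(\<Sum>m\<in>S. \<Sum>b\<in>seqs n. p m * v m b) = 1"
    using v p by (simp flip: sum_distrib_left)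
  have sum_r: "sum r (seqs n) = 1" unfolding r_def by (rule sum_p_Z[OF W code])
  \<comment> \<open>Positive part of the code's information density: the domination of
    \<open>p m * v m b\<close> may be multiplied only by something nonnegative.\<close>
  define t where "t m b = max 0 (ln (P0 m b / (r b / real K)))" for m b
  \<comment> \<open>The reference laws p and q are exchanged for the uniform law and
    \<open>r\<close>. The two correction terms sum to divergences, which are dropped below.\<close>
  have split: "p m * v m b * ln (v m b / q b) \<le> p m * v m b * (- ln \<eta>) + P0 m b / \<eta> * t m b
       - p m * v m b * ln (p m / (1 / real K)) - p m * v m b * ln (q b / r b)"
    if mb: "m \<in> S" "b \<in> seqs n" for m b
  proof (cases "v m b = 0")
    case True
    have "0 \<le> P0 m b / \<eta> * t m b" using P0(1)[of m b] S mb \<eta> by (auto simp: t_def)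
    then show ?thesis using True by simp
  next
    case False
    then have vp: "0 < v m b" using v(1)[of m b] mb by simp
    have pp: "0 < p m" using p mb by simp
    have P: "0 < P0 m b" using P0pos mb vp by simp
    have rp: "0 < r b" using P P0(2)[of m b] S mb by force
    have "p m * v m b \<le> P0 m b / \<eta>" using dom mb by (simp add: P0_def)
    then have "ln (p m * v m b) \<le> ln (P0 m b / \<eta>)" using vp pp P \<eta> by (subst ln_le_cancel_iff) auto
    then have "ln (v m b / q b) \<le> - ln \<eta> + ln (P0 m b / (r b / real K)) - ln (p m / (1 / real K)) - ln (q b / r b)"
      using vp pp P \<eta> rp K qpos[OF mb(1) vp] by (simp add: ln_div ln_mult)
    also have "\<dots> \<le> - ln \<eta> + t m b - ln (p m / (1 / real K)) - ln (q b / r b)" by (simp add: t_def)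
    finally have "p m * v m b * ln (v m b / q b) \<le> p m * v m b * (- ln \<eta> + t m b - ln (p m / (1 / real K)) - ln (q b / r b))"
      using vp pp by (intro mult_left_mono) auto
    moreover have "p m * v m b * t m b \<le> P0 m b / \<eta> * t m b"
      using dom[OF mb] by (intro mult_right_mono) (auto simp: P0_def t_def)
    ultimately show ?thesis by (simp add: algebra_simps)
  qed
  have "minfo S p v (seqs n) \<le> (\<Sum>m\<in>S. \<Sum>b\<in>seqs n. p m * v m b * (- ln \<eta>) + P0 m b / \<eta> * t m b
       - p m * v m b * ln (p m / (1 / real K)) - p m * v m b * ln (q b / r b))"
    unfolding minfo_def q_def[symmetric] by (intro sum_mono split)
  also have "\<dots> = - ln \<eta> + (\<Sum>m\<in>S. \<Sum>b\<in>seqs n. P0 m b / \<eta> * t m b)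
      - (\<Sum>m\<in>S. p m * ln (p m / (1 / real K))) - (\<Sum>b\<in>seqs n. q b * ln (q b / r b))"
  proof -
    have "(\<Sum>m\<in>S. \<Sum>b\<in>seqs n. p m * v m b * ln (p m / (1 / real K))) = (\<Sum>m\<in>S. p m * ln (p m / (1 / real K)))"
      using v by (intro sum.cong refl) (simp flip: sum_distrib_left sum_distrib_right)
    moreover have "(\<Sum>m\<in>S. \<Sum>b\<in>seqs n. p m * v m b * ln (q b / r b)) = (\<Sum>b\<in>seqs n. q b * ln (q b / r b))"
      by (subst sum.swap) (simp add: q_def out_def sum_distrib_right)
    moreover have "(\<Sum>m\<in>S. \<Sum>b\<in>seqs n. p m * v m b * (- ln \<eta>)) = - ln \<eta>"
      using total by (simp only: flip: sum_distrib_right)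
    ultimately show ?thesis by (simp only: sum_subtractf sum.distrib)
  qed
  also have "\<dots> \<le> - ln \<eta> + (mutual_info_MZ W n K phi + 1) / \<eta> - 0 - 0"
  proof (intro diff_mono add_mono order_refl)
    have "(\<Sum>m\<in>S. \<Sum>b\<in>seqs n. P0 m b / \<eta> * t m b) \<le> (\<Sum>m<K. \<Sum>b\<in>seqs n. P0 m b / \<eta> * t m b)"
      using S P0 \<eta> by (intro sum_mono2) (auto intro!: sum_nonneg simp: t_def)
    also have "\<dots> \<le> (\<Sum>m<K. \<Sum>b\<in>seqs n. (P0 m b * ln (P0 m b / (r b / real K)) + r b / real K) / \<eta>)"
    proof (intro sum_mono)
      fix m and b :: "'z list" assume mb: "m \<in> {..<K}" "b \<in> seqs n"
      \<comment> \<open>The negative part of \<open>P * ln (P / Q)\<close> is at most Q, and here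
        the Q sum to 1: this is the \<open>+ 1\<close> beside the mutual information.\<close>
      have g: "P0 m b - r b / real K \<le> P0 m b * ln (P0 m b / (r b / real K))"
        using P0[of m b] mb K by (intro gibbs_term) auto
      have "P0 m b * t m b \<le> P0 m b * ln (P0 m b / (r b / real K)) + r b / real K"
        using g P0[of m b] mb by (cases "0 \<le> ln (P0 m b / (r b / real K))") (auto simp: t_def)
      then have "(P0 m b * t m b) / \<eta> \<le> (P0 m b * ln (P0 m b / (r b / real K)) + r b / real K) / \<eta>"
        using \<eta> by (intro divide_right_mono) auto
      then show "P0 m b / \<eta> * t m b \<le> (P0 m b * ln (P0 m b / (r b / real K)) + r b / real K) / \<eta>" by simp
    qed
    also have "\<dots> = (mutual_info_MZ W n K phi + 1) / \<eta>"
      using sum_r K by (simp add: sum.distrib mutual_info_MZ_eq P0_def r_def flip: sum_divide_distrib)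
    finally show "(\<Sum>m\<in>S. \<Sum>b\<in>seqs n. P0 m b / \<eta> * t m b) \<le> (mutual_info_MZ W n K phi + 1) / \<eta>" .
    have "(\<Sum>m\<in>S. 1 / real K) \<le> (\<Sum>m<K. 1 / real K)" using S by (intro sum_mono2) auto
    then show "0 \<le> (\<Sum>m\<in>S. p m * ln (p m / (1 / real K)))"
      using p K by (intro gibbs) (auto simp: less_imp_le)
    show "0 \<le> (\<Sum>b\<in>seqs n. q b * ln (q b / r b))"
    proof (rule gibbs)
      show "q b = 0" if b: "b \<in> seqs n" "r b = 0" for b
      proof -
        have "v m b = 0" if "m \<in> S" for m
          using P0pos[OF that b(1)] P0(2)[of m b] b S that v(1)[OF that, of b] by (force simp: less_le)
        then show ?thesis by (simp add: q_def out_def)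
      qed
      show "sum r (seqs n) \<le> sum q (seqs n)"
        using sum_r p v by (simp add: q_def sum_out)
      show "0 \<le> r b" if "b \<in> seqs n" for b using p_Z_nonneg[OF W code that] by (simp add: r_def)
    qed (use q0 in auto)
  qed
  finally show ?thesis by simp
qed

text \<open>Conditioning on an event of probability at least \<eta> multiplies probabilities by at
  most \<open>1 / \<eta>\<close>. This costs one \<open>ln \<eta>\<close> in the entropy of the
  message and one in the leakage, and it scales the leakage itself. The terms in s are the price of
  the noisy guess.\<close>

lemma information_difference_ge:
  fixes W :: "'x::finite \<Rightarrow> 'y::finite \<Rightarrow> 'z::finite \<Rightarrow> real"
  assumes W: "is_channel W" and code: "is_code n K phi psi"
    and \<eta>: "0 < \<eta>" "2 * \<eta> \<le> prob_correct W n K phi psi" and s: "0 < s" "s < 1"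
  obtains S :: "nat set" and p f where "finite S"
    "\<And>m. m \<in> S \<Longrightarrow> 0 < p m" "sum p S = 1" "\<And>m xs. m \<in> S \<Longrightarrow> 0 \<le> f m xs"
    "\<And>m. m \<in> S \<Longrightarrow> (\<Sum>xs\<in>seqs n. f m xs) = 1"
    "ln (real K) + 2 * ln \<eta> + real n * ln (1 - s) - ln (real CARD('y) / s) * sqrt (real n / \<eta>)
       - (mutual_info_MZ W n K phi + 1) / \<eta>
     \<le> minfo S p (outch f (margY W) n) (seqs n) - minfo S p (outch f (margZ W) n) (seqs n)"
proof -
  have K: "0 < real K" using code by (simp add: is_code_def)
  have phi0: "0 \<le> phi m xs" and phi_sum: "(\<Sum>xs\<in>seqs n. phi m xs) = 1" if "m < K" for m xs
    using code that by (auto simp: is_code_def)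
  have VY: "stochastic (margY W)" and VZ: "stochastic (margZ W)"
    using W by (auto intro: stochastic_margY stochastic_margZ)
  define D where "D m = {ys\<in>seqs n. psi ys = m}" for m
  define w where "w m xs = (\<Sum>ys\<in>D m. wn (margY W) xs ys)" for m xs
  define g where "g m xs = (if \<eta> \<le> w m xs then phi m xs / real K else 0)" for m xs
  define PG where "PG = (\<Sum>m<K. \<Sum>xs\<in>seqs n. g m xs)"
  have w1: "w m xs \<le> 1" if "xs \<in> seqs n" for m xs
  proof -
    have "w m xs \<le> (\<Sum>ys\<in>seqs n. wn (margY W) xs ys)" unfolding w_def
      using VY by (intro sum_mono2) (auto simp: D_def wn_nonneg)
    then show ?thesis using sum_wn[OF VY length_seqs[OF that]] by simp
  qed
  \<comment> \<open>The mean of \<open>w\<close> is the probability of correct decoding. A mean of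
    at least \<open>2 * \<eta>\<close> for values in \<open>[0, 1]\<close> leaves mass at least
    \<eta> on the values that are at least \<eta>.\<close>
  have PG: "\<eta> \<le> PG"
  proof -
    have "prob_correct W n K phi psi
      = (1 / real K) * (\<Sum>m<K. \<Sum>ys\<in>D m. outch phi (margY W) n (psi ys) ys)"
      unfolding prob_correct_eq[OF code] D_def using code
      by (subst sum.group) (auto simp: is_code_def)
    also have "\<dots> = (1 / real K) * (\<Sum>m<K. \<Sum>ys\<in>D m. outch phi (margY W) n m ys)"
      by (intro arg_cong[where f = "\<lambda>x. 1 / real K * x"] sum.cong refl) (simp add: D_def)
    also have "\<dots> = (\<Sum>m<K. \<Sum>xs\<in>seqs n. phi m xs / real K * w m xs)"
      unfolding outch_def w_def
      by (subst sum.swap[of _ "seqs n"]) (simp add: sum_distrib_left sum_divide_distrib)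
    also have "\<dots> \<le> (\<Sum>m<K. \<Sum>xs\<in>seqs n. g m xs + \<eta> * (phi m xs / real K))"
    proof (intro sum_mono)
      fix m and xs :: "'x list" assume m: "m \<in> {..<K}" "xs \<in> seqs n"
      have c: "0 \<le> phi m xs / real K" using phi0 m by simp
      have "w m xs \<le> (if \<eta> \<le> w m xs then 1 else 0) + \<eta>" using w1[OF m(2), of m] \<eta> by auto
      then have "phi m xs / real K * w m xs \<le> phi m xs / real K * ((if \<eta> \<le> w m xs then 1 else 0) + \<eta>)"
        using c by (intro mult_left_mono)
      then show "phi m xs / real K * w m xs \<le> g m xs + \<eta> * (phi m xs / real K)"
        by (simp add: g_def algebra_simps split: if_splits)
    qed
    also have "\<dots> = PG + \<eta>"
      using phi_sum K by (simp add: sum.distrib PG_def flip: sum_distrib_left sum_divide_distrib)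
    finally show ?thesis using \<eta> by linarith
  qed
  have PG0: "0 < PG" using PG \<eta> by linarith
  have g0: "0 \<le> g m xs" if "m < K" for m xs using phi0[OF that] by (simp add: g_def)
  have g_le: "g m xs \<le> phi m xs / real K" if "m < K" for m xs using phi0[OF that] by (simp add: g_def)
  \<comment> \<open>Joint law of message and input given the good event; \<open>p\<close> is its
    message marginal, \<open>S\<close> the support of \<open>p\<close>, and \<open>f\<close> the
    conditional encoder.\<close>
  define J where "J m xs = g m xs / PG" for m xs
  define p where "p m = (\<Sum>xs\<in>seqs n. J m xs)" for m
  define S where "S = {m. m < K \<and> 0 < p m}"
  define f where "f m xs = J m xs / p m" for m xs
  have J0: "0 \<le> J m xs" if "m < K" for m xs using g0[OF that] PG0 by (simp add: J_def)
  have J_le: "J m xs \<le> (phi m xs / real K) / \<eta>" if "m < K" for m xs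
  proof -
    have "J m xs \<le> g m xs / \<eta>" unfolding J_def using g0[OF that] PG PG0 \<eta> by (intro divide_left_mono) auto
    also have "\<dots> \<le> (phi m xs / real K) / \<eta>" using g_le[OF that] \<eta> by (intro divide_right_mono) auto
    finally show ?thesis .
  qed
  have p0: "0 \<le> p m" if "m < K" for m unfolding p_def using J0[OF that] by (intro sum_nonneg)
  have finS: "finite S" by (simp add: S_def)
  have SK: "S \<subseteq> {..<K}" by (auto simp: S_def)
  have p_pos: "0 < p m" if "m \<in> S" for m using that by (simp add: S_def)
  have p_sum: "sum p S = 1"
  proof -
    have "sum p S = sum p {..<K}" using p0 by (intro sum.mono_neutral_left) (auto simp: S_def less_le)
    also have "\<dots> = 1" using PG0 by (simp add: p_def J_def PG_def flip: sum_divide_distrib)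
    finally show ?thesis .
  qed
  have f0: "0 \<le> f m xs" if "m \<in> S" for m xs using that J0 p_pos[OF that] by (simp add: f_def S_def)
  have f_sum: "(\<Sum>xs\<in>seqs n. f m xs) = 1" if "m \<in> S" for m
    using p_pos[OF that] by (simp add: f_def p_def flip: sum_divide_distrib)
  have pv: "p m * outch f V n m b = (\<Sum>xs\<in>seqs n. J m xs * wn V xs b)" if "m \<in> S"
    for m b and V :: "'x \<Rightarrow> 'b \<Rightarrow> real"
    using p_pos[OF that] by (simp add: outch_def f_def sum_distrib_left)
  define vY where "vY = outch f (margY W) n"
  have vY: "0 \<le> vY m a" "(\<Sum>a\<in>seqs n. vY m a) = 1" if "m \<in> S" for m a
    using that f0 f_sum VY by (auto simp: vY_def sum_outch intro!: outch_nonneg)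
  have "minfo S p (outch f (margZ W) n) (seqs n) \<le> - ln \<eta> + (mutual_info_MZ W n K phi + 1) / \<eta>"
  proof (rule minfo_le_mutual_info[OF W code SK p_pos p_sum _ _ \<eta>(1)])
    fix m and b :: "'z list" assume m: "m \<in> S" and b: "b \<in> seqs n"
    have "p m * outch f (margZ W) n m b \<le> (\<Sum>xs\<in>seqs n. (phi m xs / real K) / \<eta> * wn (margZ W) xs b)"
      unfolding pv[OF m] using J_le m VZ by (intro sum_mono mult_right_mono) (auto simp: S_def wn_nonneg)
    also have "\<dots> = p_MZ W n K phi m b / \<eta>"
      using b by (simp add: p_MZ_eq outch_def sum_divide_distrib)
    finally show "p m * outch f (margZ W) n m b \<le> p_MZ W n K phi m b / \<eta>" .
  qed (use f0 f_sum VZ in \<open>auto simp: sum_outch intro!: outch_nonneg\<close>)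
  moreover have "ln (real K) + ln \<eta> + real n * ln (1 - s) - ln (real CARD('y) / s) * sqrt (real n / \<eta>)
     \<le> minfo S p vY (seqs n)"
  proof -
    define d where "d = ln (real CARD('y) / s)"
    have card1: "1 \<le> real CARD('y)" by (simp add: Suc_le_eq)
    have "s \<le> real CARD('y)" using s card1 by linarith
    then have d0: "0 \<le> d" unfolding d_def using s by (intro ln_ge_zero) (simp add: le_divide_eq)
    have good: "\<eta> \<le> w m xs" if "m < K" "J m xs \<noteq> 0" for m xs
      using that by (auto simp: J_def g_def split: if_splits)
    \<comment> \<open>A message of positive probability has some good input, from which its decoding
      set is hit with positive probability.\<close>
    have D0: "D m \<noteq> {}" if m: "m \<in> S" for m
    proof -
      obtain xs where "J m xs \<noteq> 0"
        using p_pos[OF m] unfolding p_def by (metis less_irrefl sum.neutral)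
      then have "\<eta> \<le> w m xs" using m good by (auto simp: S_def)
      then show ?thesis using \<eta> by (auto simp: w_def)
    qed
    have dist: "(\<Sum>m\<in>S. \<Sum>a\<in>seqs n. p m * vY m a * real (setdist (D m) a)) \<le> sqrt (real n / \<eta>)"
    proof -
      have "(\<Sum>m\<in>S. \<Sum>a\<in>seqs n. p m * vY m a * real (setdist (D m) a))
        = (\<Sum>m\<in>S. \<Sum>a\<in>seqs n. \<Sum>xs\<in>seqs n. J m xs * (wn (margY W) xs a * real (setdist (D m) a)))"
        unfolding vY_def by (intro sum.cong refl) (simp add: pv sum_distrib_right mult.assoc)
      also have "\<dots> = (\<Sum>m\<in>S. \<Sum>xs\<in>seqs n. J m xs * (\<Sum>a\<in>seqs n. wn (margY W) xs a * real (setdist (D m) a)))"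
        by (intro sum.cong refl, subst sum.swap) (simp add: sum_distrib_left)
      also have "\<dots> \<le> (\<Sum>m\<in>S. \<Sum>xs\<in>seqs n. J m xs * sqrt (real n / \<eta>))"
      proof (intro sum_mono)
        fix m and xs :: "'x list" assume m: "m \<in> S" and xs: "xs \<in> seqs n"
        show "J m xs * (\<Sum>a\<in>seqs n. wn (margY W) xs a * real (setdist (D m) a)) \<le> J m xs * sqrt (real n / \<eta>)"
        proof (cases "J m xs = 0")
          case False
          then have "(\<Sum>a\<in>seqs n. wn (margY W) xs a * real (setdist (D m) a)) \<le> sqrt (real n / \<eta>)"
            using good[of m xs] m xs \<eta> VY
            by (intro expected_setdist) (auto simp: w_def S_def D_def length_seqs)
          then show ?thesis using J0 m by (intro mult_left_mono) (auto simp: S_def)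
        qed simp
      qed
      also have "\<dots> = sqrt (real n / \<eta>)"
        using p_sum by (simp add: p_def flip: sum_distrib_right)
      finally show ?thesis .
    qed
    have total: "(\<Sum>m\<in>S. \<Sum>a\<in>seqs n. p m * vY m a) = 1"
      using vY p_sum by (simp flip: sum_distrib_left)
    have "real n * ln (1 - s) - d * sqrt (real n / \<eta>)
      \<le> real n * ln (1 - s) - d * (\<Sum>m\<in>S. \<Sum>a\<in>seqs n. p m * vY m a * real (setdist (D m) a))"
      using dist d0 by (intro diff_mono mult_left_mono) auto
    also have "\<dots> = (\<Sum>m\<in>S. \<Sum>a\<in>seqs n. p m * vY m a * (real n * ln (1 - s)) - d * (p m * vY m a * real (setdist (D m) a)))"
      using total by (simp add: sum_subtractf flip: sum_distrib_left sum_distrib_right)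
    also have "\<dots> \<le> (\<Sum>m\<in>S. \<Sum>a\<in>seqs n. p m * vY m a * ln (listprob s n psi m a))"
    proof (intro sum_mono)
      fix m and a :: "'y list" assume m: "m \<in> S" and a: "a \<in> seqs n"
      have "p m * vY m a * (real n * ln (1 - s) - real (setdist (D m) a) * d)
        \<le> p m * vY m a * ln (listprob s n psi m a)"
        unfolding d_def using listprob_ge(2)[OF s a D_def D0[OF m]] p_pos[OF m] vY[OF m]
        by (intro mult_left_mono) auto
      then show "p m * vY m a * (real n * ln (1 - s)) - d * (p m * vY m a * real (setdist (D m) a))
        \<le> p m * vY m a * ln (listprob s n psi m a)"
        by (simp add: algebra_simps)
    qed
    finally have *: "real n * ln (1 - s) - d * sqrt (real n / \<eta>)
      \<le> (\<Sum>m\<in>S. \<Sum>a\<in>seqs n. p m * vY m a * ln (listprob s n psi m a))" .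
    have "(ln (real K) + ln \<eta>) + (\<Sum>m\<in>S. \<Sum>a\<in>seqs n. p m * vY m a * ln (listprob s n psi m a))
      \<le> minfo S p vY (seqs n)"
    proof (rule minfo_ge[OF finS _ p_pos p_sum vY])
      fix m assume m: "m \<in> S"
      have "p m \<le> (\<Sum>xs\<in>seqs n. (phi m xs / real K) / \<eta>)"
        unfolding p_def using J_le m by (intro sum_mono) (auto simp: S_def)
      also have "\<dots> = 1 / (real K * \<eta>)"
        using phi_sum m by (simp add: S_def flip: sum_divide_distrib)
      also have "\<dots> = exp (- (ln (real K) + ln \<eta>))"
        using K \<eta> by (simp add: exp_diff exp_minus field_simps)
      finally show "p m \<le> exp (- (ln (real K) + ln \<eta>))" .
    next
      fix m and a :: "'y list" assume "m \<in> S" "a \<in> seqs n"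
      then show "0 < listprob s n psi m a"
        using listprob_ge(1)[OF s _ D_def D0] by blast
    qed (use s finS in \<open>auto intro: sum_listprob\<close>)
    then show ?thesis using * by (simp add: d_def)
  qed
  ultimately have "ln (real K) + 2 * ln \<eta> + real n * ln (1 - s) - ln (real CARD('y) / s) * sqrt (real n / \<eta>)
       - (mutual_info_MZ W n K phi + 1) / \<eta>
     \<le> minfo S p (outch f (margY W) n) (seqs n) - minfo S p (outch f (margZ W) n) (seqs n)"
    by (simp add: vY_def)
  then show thesis
    by (intro that[of S p f] finS p_pos p_sum f0 f_sum)
qed

section \<open>The strong converse and the supremum of achievable rates\<close>

lemma eps_achievable_eventually:
  fixes W :: "'x::finite \<Rightarrow> 'y::finite \<Rightarrow> 'z::finite \<Rightarrow> real"
  assumes "eps_achievable W \<epsilon> R" "\<epsilon> < \<epsilon>'" "R' < R"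
  obtains K phi psi where "\<And>n. 1 \<le> n \<Longrightarrow> is_code n (K n) (phi n) (psi n)"
    "\<forall>\<^sub>F n in sequentially. prob_error W n (K n) (phi n) (psi n) < \<epsilon>'"
    "\<forall>\<^sub>F n in sequentially. R' < ln (real (K n)) / real n"
    "(\<lambda>n. mutual_info_MZ W n (K n) (phi n) / real n) \<longlonglongrightarrow> 0"
proof -
  obtain K phi psi where *: "\<And>n. 1 \<le> n \<Longrightarrow> is_code n (K n) (phi n) (psi n)"
    "limsup (\<lambda>n. ereal (prob_error W n (K n) (phi n) (psi n))) \<le> ereal \<epsilon>"
    "ereal R \<le> liminf (\<lambda>n. ereal (ln (real (K n)) / real n))"
    "(\<lambda>n. mutual_info_MZ W n (K n) (phi n) / real n) \<longlonglongrightarrow> 0"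
    using assms(1) unfolding eps_achievable_def by blast
  have "limsup (\<lambda>n. ereal (prob_error W n (K n) (phi n) (psi n))) < ereal \<epsilon>'"
    using *(2) assms(2) by (intro order.strict_trans1[OF *(2)]) simp
  then have "\<forall>\<^sub>F n in sequentially. ereal (prob_error W n (K n) (phi n) (psi n)) < ereal \<epsilon>'"
    by (rule Limsup_lessD)
  moreover have "ereal R' < liminf (\<lambda>n. ereal (ln (real (K n)) / real n))"
    using assms(3) by (intro order.strict_trans2[OF _ *(3)]) simp
  then have "\<forall>\<^sub>F n in sequentially. ereal R' < ereal (ln (real (K n)) / real n)"
    by (rule less_LiminfD)
  ultimately show thesis using * by (intro that[of K phi psi]) auto
qed

lemma strong_converse:
  fixes W :: "'x::finite \<Rightarrow> 'y::finite \<Rightarrow> 'z::finite \<Rightarrow> real"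
  assumes W: "is_channel W" and \<epsilon>: "\<epsilon> < 1" and R: "eps_achievable W \<epsilon> R" and R': "0 \<le> R'" "R' < R"
  shows "eps_achievable W 0 R'"
proof -
  \<comment> \<open>Then \<open>1 - 2 * \<eta> = (1 + \<epsilon>) / 2\<close> lies strictly between
    \<epsilon> and 1, and an error below it means correct decoding with probability at least
    \<open>2 * \<eta>\<close>.\<close>
  define \<eta> where "\<eta> = (1 - \<epsilon>) / 4"
  have \<eta>: "0 < \<eta>" "\<epsilon> < 1 - 2 * \<eta>" using \<epsilon> by (auto simp: \<eta>_def field_simps)
  \<comment> \<open>The code rate will exceed \<open>R'\<close> by three of the four parts of the
    gap: one pays for \<open>ln (1 - s)\<close>, which the choice of s makes equal to
    \<open>- \<gamma>\<close>, one for the sublinear terms, and one keeps the final inequality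
    strict.\<close>
  define \<gamma> where "\<gamma> = (R - R') / 4"
  have \<gamma>: "0 < \<gamma>" "R' + 3 * \<gamma> < R" using R' by (auto simp: \<gamma>_def field_simps)
  define s where "s = 1 - exp (- \<gamma>)"
  have s: "0 < s" "s < 1" "ln (1 - s) = - \<gamma>" using \<gamma> by (auto simp: s_def)
  define d where "d = ln (real CARD('y) / s)"
  obtain K phi psi where code: "\<And>n. 1 \<le> n \<Longrightarrow> is_code n (K n) (phi n) (psi n)"
    and err: "\<forall>\<^sub>F n in sequentially. prob_error W n (K n) (phi n) (psi n) < 1 - 2 * \<eta>"
    and rate: "\<forall>\<^sub>F n in sequentially. R' + 3 * \<gamma> < ln (real (K n)) / real n"
    and leak: "(\<lambda>n. mutual_info_MZ W n (K n) (phi n) / real n) \<longlonglongrightarrow> 0"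
    using eps_achievable_eventually[OF R \<eta>(2) \<gamma>(2)] by blast
  have "(\<lambda>n. (2 * ln \<eta> - 1 / \<eta>) / real n - d * (sqrt (real n / \<eta>) / real n)
      - (mutual_info_MZ W n (K n) (phi n) / real n) / \<eta>) \<longlonglongrightarrow> 0 - d * 0 - 0 / \<eta>"
  proof (intro tendsto_diff tendsto_mult tendsto_divide tendsto_const leak)
    show "(\<lambda>n. (2 * ln \<eta> - 1 / \<eta>) / real n) \<longlonglongrightarrow> 0" by real_asymp
    show "(\<lambda>n. sqrt (real n / \<eta>) / real n) \<longlonglongrightarrow> 0" using \<eta> by real_asymp
  qed (use \<eta> in auto)
  then have "\<forall>\<^sub>F n in sequentially. - \<gamma> < (2 * ln \<eta> - 1 / \<eta>) / real n - d * (sqrt (real n / \<eta>) / real n)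
      - (mutual_info_MZ W n (K n) (phi n) / real n) / \<eta>"
    using \<gamma> by (intro order_tendstoD(1)) auto
  then have "\<forall>\<^sub>F n in sequentially. 1 \<le> n \<and> prob_error W n (K n) (phi n) (psi n) < 1 - 2 * \<eta>
    \<and> R' + 3 * \<gamma> < ln (real (K n)) / real n
    \<and> - \<gamma> < (2 * ln \<eta> - 1 / \<eta>) / real n - d * (sqrt (real n / \<eta>) / real n)
      - (mutual_info_MZ W n (K n) (phi n) / real n) / \<eta>"
    using err rate eventually_ge_at_top[of 1] by eventually_elim auto
  then obtain n where n: "1 \<le> n" "prob_error W n (K n) (phi n) (psi n) < 1 - 2 * \<eta>"
    "R' + 3 * \<gamma> < ln (real (K n)) / real n"
    "- \<gamma> < (2 * ln \<eta> - 1 / \<eta>) / real n - d * (sqrt (real n / \<eta>) / real n)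
      - (mutual_info_MZ W n (K n) (phi n) / real n) / \<eta>"
    using eventually_happens'[OF sequentially_bot] by blast
  have correct: "2 * \<eta> \<le> prob_correct W n (K n) (phi n) (psi n)"
    using n(2) by (simp add: prob_error_def)
  obtain S :: "nat set" and p f where *: "finite S"
    "\<And>m. m \<in> S \<Longrightarrow> 0 < p m" "sum p S = 1" "\<And>m xs. m \<in> S \<Longrightarrow> 0 \<le> f m xs"
    "\<And>m. m \<in> S \<Longrightarrow> (\<Sum>xs\<in>seqs n. f m xs) = 1"
    and info: "ln (real (K n)) + 2 * ln \<eta> + real n * ln (1 - s) - d * sqrt (real n / \<eta>)
       - (mutual_info_MZ W n (K n) (phi n) + 1) / \<eta>
     \<le> minfo S p (outch f (margY W) n) (seqs n) - minfo S p (outch f (margZ W) n) (seqs n)"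
    using information_difference_ge[OF W code[OF n(1)] \<eta>(1) correct s(1,2)] unfolding d_def by metis
  have "real n * R' < ln (real (K n)) + 2 * ln \<eta> + real n * ln (1 - s) - d * sqrt (real n / \<eta>)
       - (mutual_info_MZ W n (K n) (phi n) + 1) / \<eta>"
  proof -
    have n0: "0 < real n" using n(1) by simp
    have "real n * (R' + 3 * \<gamma>) < ln (real (K n))" using n(3) n0 by (simp add: field_simps)
    moreover have "real n * (- \<gamma>) < 2 * ln \<eta> - 1 / \<eta> - d * sqrt (real n / \<eta>) - mutual_info_MZ W n (K n) (phi n) / \<eta>"
    proof -
      have "real n * (- \<gamma>) < real n * ((2 * ln \<eta> - 1 / \<eta>) / real n - d * (sqrt (real n / \<eta>) / real n)
      - (mutual_info_MZ W n (K n) (phi n) / real n) / \<eta>)"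
        using n(4) n0 by (rule mult_strict_left_mono)
      also have "\<dots> = 2 * ln \<eta> - 1 / \<eta> - d * sqrt (real n / \<eta>) - mutual_info_MZ W n (K n) (phi n) / \<eta>"
      proof -
        have "real n * (c / real n - d * (x / real n) - (y / real n) / \<eta>) = c - d * x - y / \<eta>" for c x y
          using n0 by (simp add: right_diff_distrib)
        then show ?thesis .
      qed
      finally show ?thesis .
    qed
    moreover have "0 < real n * \<gamma>" using n0 \<gamma> by simp
    ultimately show ?thesis by (simp add: s(3) add_divide_distrib algebra_simps)
  qed
  then have "real n * R' < minfo S p (outch f (margY W) n) (seqs n) - minfo S p (outch f (margZ W) n) (seqs n)"
    using info by linarith
  then show ?thesis
    using * by (intro achievability[OF W n(1) _ _ _ _ _ R'(1), of S p f])
qed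

text \<open>Counting: there are \<open>CARD('y) ^ n\<close> outputs, and each adds at most
  \<open>1 / K\<close> to the probability of correct decoding. This bounds the set of rates, so that
  \<open>Sup\<close> is a genuine supremum. The absolute value keeps the constant from shrinking
  under multiplication by n.\<close>

lemma achievable_rate_le:
  fixes W :: "'x::finite \<Rightarrow> 'y::finite \<Rightarrow> 'z::finite \<Rightarrow> real"
  assumes W: "is_channel W" and \<epsilon>: "\<epsilon> < 1" and R: "eps_achievable W \<epsilon> R"
  shows "R \<le> ln (real CARD('y)) + \<bar>ln (2 / (1 - \<epsilon>))\<bar>"
proof (rule ccontr)
  define B where "B = ln (real CARD('y)) + \<bar>ln (2 / (1 - \<epsilon>))\<bar>"
  assume "\<not> ?thesis"
  then have B: "B < R" by (simp only: B_def not_le)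
  have \<epsilon>': "\<epsilon> < (1 + \<epsilon>) / 2" using \<epsilon> by (simp add: field_simps)
  obtain K phi psi where code: "\<And>n. 1 \<le> n \<Longrightarrow> is_code n (K n) (phi n) (psi n)"
    and err: "\<forall>\<^sub>F n in sequentially. prob_error W n (K n) (phi n) (psi n) < (1 + \<epsilon>) / 2"
    and rate: "\<forall>\<^sub>F n in sequentially. B < ln (real (K n)) / real n"
    and "(\<lambda>n. mutual_info_MZ W n (K n) (phi n) / real n) \<longlonglongrightarrow> 0"
    using eps_achievable_eventually[OF R \<epsilon>' B] by blast
  from err rate eventually_ge_at_top[of 1]
  have "\<forall>\<^sub>F n in sequentially. 1 \<le> n \<and> prob_error W n (K n) (phi n) (psi n) < (1 + \<epsilon>) / 2
     \<and> B < ln (real (K n)) / real n"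
    by eventually_elim auto
  then obtain n where n: "1 \<le> n" "prob_error W n (K n) (phi n) (psi n) < (1 + \<epsilon>) / 2"
    "B < ln (real (K n)) / real n"
    using eventually_happens'[OF sequentially_bot] by blast
  note code = code[OF n(1)]
  have K: "0 < real (K n)" using code by (simp add: is_code_def)
  have "outch (phi n) (margY W) n m ys \<le> 1" if "m < K n" "ys \<in> seqs n" for m ys
  proof -
    have "outch (phi n) (margY W) n m ys \<le> (\<Sum>ys\<in>seqs n. outch (phi n) (margY W) n m ys)"
      using that code W
      by (intro member_le_sum) (auto simp: is_code_def intro!: outch_nonneg stochastic_margY)
    also have "\<dots> = 1" using that code W by (simp add: sum_outch stochastic_margY is_code_def)
    finally show ?thesis .
  qed
  then have "(\<Sum>ys\<in>seqs n. outch (phi n) (margY W) n (psi n ys) ys) \<le> (\<Sum>ys\<in>(seqs n :: 'y list set). 1)"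
    using code by (intro sum_mono) (auto simp: is_code_def)
  also have "\<dots> = real CARD('y) ^ n"
    using card_lists_length_eq[of "UNIV :: 'y set" n] by (simp add: seqs_def)
  finally have "prob_correct W n (K n) (phi n) (psi n) \<le> real CARD('y) ^ n / real (K n)"
    using K by (simp add: prob_correct_eq[OF code] divide_right_mono)
  then have "(1 - \<epsilon>) / 2 \<le> real CARD('y) ^ n / real (K n)"
    using n(2) by (simp add: prob_error_def field_simps)
  then have "real (K n) \<le> real CARD('y) ^ n * (2 / (1 - \<epsilon>))"
    using K \<epsilon> by (simp add: field_simps)
  then have "ln (real (K n)) \<le> ln (real CARD('y) ^ n * (2 / (1 - \<epsilon>)))"
    using K \<epsilon> by (subst ln_le_cancel_iff) auto
  also have "\<dots> = real n * ln (real CARD('y)) + ln (2 / (1 - \<epsilon>))"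
    using \<epsilon> by (subst ln_mult) (auto simp: ln_realpow)
  also have "\<dots> \<le> real n * ln (real CARD('y)) + real n * \<bar>ln (2 / (1 - \<epsilon>))\<bar>"
  proof -
    have "1 * \<bar>ln (2 / (1 - \<epsilon>))\<bar> \<le> real n * \<bar>ln (2 / (1 - \<epsilon>))\<bar>"
      using n(1) by (intro mult_right_mono) auto
    then show ?thesis by linarith
  qed
  also have "\<dots> = real n * B" by (simp add: B_def distrib_left)
  finally show False using n(1,3) by (simp add: field_simps)
qed

text \<open>A code with a single message has neither error nor leakage. Rate 0 makes the set of
  rates nonempty and its supremum nonnegative, and \<open>strong_converse\<close> asks for a
  nonnegative target rate.\<close>

lemma zero_achievable:
  fixes W :: "'x::finite \<Rightarrow> 'y::finite \<Rightarrow> 'z::finite \<Rightarrow> real"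
  assumes W: "is_channel W" and \<epsilon>: "0 \<le> \<epsilon>"
  shows "eps_achievable W \<epsilon> 0"
proof -
  define phi :: "nat \<Rightarrow> nat \<Rightarrow> 'x list \<Rightarrow> real"
    where "phi n m xs = (if xs = replicate n undefined then 1 else 0)" for n m xs
  define psi :: "'y list \<Rightarrow> nat" where "psi ys = 0" for ys
  have code: "is_code n 1 (phi n) psi" for n
  proof -
    have "replicate n undefined \<in> (seqs n :: 'x list set)" by (simp add: seqs_def)
    then show ?thesis by (simp add: is_code_def phi_def psi_def sum.delta)
  qed
  have "prob_correct W n 1 (phi n) psi = 1" for n
    unfolding prob_correct_eq[OF code] using code[of n] W by (simp add: psi_def sum_outch stochastic_margY is_code_def)
  then have err: "prob_error W n 1 (phi n) psi = 0" for n by (simp add: prob_error_def)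
  have mi: "mutual_info_MZ W n 1 (phi n) = 0" for n
    by (auto simp: mutual_info_MZ_eq p_Z_def intro!: sum.neutral)
  have "limsup (\<lambda>n. ereal (prob_error W n 1 (phi n) psi)) \<le> ereal \<epsilon>"
    unfolding err using \<epsilon> by (simp add: Limsup_const)
  moreover have "ereal 0 \<le> liminf (\<lambda>n. ereal (ln (real 1) / real n))"
    by (simp add: Liminf_const flip: zero_ereal_def)
  ultimately show ?thesis
    unfolding eps_achievable_def using code mi
    by (intro exI[of _ "\<lambda>_. 1"] exI[of _ phi] exI[of _ "\<lambda>_. psi"]) auto
qed

theorem theorem1:
  fixes W :: "'x::finite \<Rightarrow> 'y::finite \<Rightarrow> 'z::finite \<Rightarrow> real" and \<epsilon> :: real
  assumes "is_channel W"
    and "0 \<le> \<epsilon>" and "\<epsilon> < 1"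
  shows "secrecy_capacity W \<epsilon> = secrecy_capacity W 0"
proof (rule antisym)
  define A where "A e = {R. eps_achievable W e R}" for e
  have bdd: "bdd_above (A e)" if "e < 1" for e
    using achievable_rate_le[OF assms(1) that] unfolding A_def by (intro bdd_aboveI) auto
  have zero: "0 \<in> A e" if "0 \<le> e" for e
    using zero_achievable[OF assms(1) that] by (simp add: A_def)
  have mono: "A 0 \<subseteq> A \<epsilon>"
  proof
    have "ereal 0 \<le> ereal \<epsilon>" using assms(2) by simp
    then show "R \<in> A \<epsilon>" if "R \<in> A 0" for R
      using that unfolding A_def eps_achievable_def mem_Collect_eq by (meson order_trans)
  qed
  show "secrecy_capacity W 0 \<le> secrecy_capacity W \<epsilon>"
    unfolding secrecy_capacity_def A_def[symmetric]
    using zero[of 0] bdd[OF assms(3)] mono by (intro cSup_subset_mono) auto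
  show "secrecy_capacity W \<epsilon> \<le> secrecy_capacity W 0"
    unfolding secrecy_capacity_def A_def[symmetric]
  proof (rule cSup_least)
    show "A \<epsilon> \<noteq> {}" using zero[OF assms(2)] by auto
    fix R assume R: "R \<in> A \<epsilon>"
    show "R \<le> Sup (A 0)"
    proof (rule ccontr)
      assume "\<not> ?thesis"
      then have less: "Sup (A 0) < R" by simp
      have "0 \<le> Sup (A 0)" using zero[of 0] bdd[of 0] by (intro cSup_upper) auto
      \<comment> \<open>The midpoint is taken because \<open>strong_converse\<close> yields rates
        strictly below R only.\<close>
      then have "(Sup (A 0) + R) / 2 \<in> A 0"
        using strong_converse[OF assms(1,3), of R "(Sup (A 0) + R) / 2"] R less by (simp add: A_def)
      then have "(Sup (A 0) + R) / 2 \<le> Sup (A 0)" using bdd[of 0] by (intro cSup_upper) auto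
      then show False using less by simp
    qed
  qed
qed

end
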